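(* Let $G$ be a finite simple graph. Then $G$ admits a tree 3-spanner of diameter at most 5 if and only if Algorithm T3SD5 (described in the context), run on input $G$, returns YES. This holds for every way of making the arbitrary choices in the algorithm: the order in which edges are examined, and which uncovered component is picked at each step of the construction of $\mathcal{C}^u$ and $\mathcal{C}^v$.
   Context: All graphs are finite, simple and loopless. For a graph $G$ and a vertex $x$, $N_G(x)$ is the set of neighbours of $x$ and $N_G[x]=N_G(x)\cup\{x\}$. For a subgraph $H$, $N_G[H]=\bigcup_{x\in V(H)}N_G[x]$ and $N_G(H)=N_G[H]\setminus V(H)$. For an edge $uv$, $N_G[u,v]=N_G[u]\cup N_G[v]$. Distances $d_G$ are shortest-path lengths. A tree $t$-spanner of $G$ is a spanning subgraph $T$ of $G$ that is a tree and satisfies $d_T(a,b)\le t\cdot d_G(a,b)$ for every pair of vertices $a,b$ of $G$. Algorithm T3SD5($G$). If $E(G)=\emptyset$, return YES if $|V(G)|\le 1$ and NO otherwise. Otherwise examine the edges $uv$ of $G$ one at a time. For the current edge $uv$: (i) Let $\mathcal{Q}$ be the set of connected components of $G-N_G[u,v]$. If $\mathcal{Q}=\emptyset$, return YES. (ii) For $x\in\{u,v\}$ and $Q\in\mathcal{Q}$, a structure $S(x,Q)$ is defined as follows. Let $Q^x$ be the component of $G-N_G[x]$ containing $Q$. Set $M=\{X\in\mathcal{Q}: X\subseteq Q^x\}$ and $U=V(Q^x)\setminus\bigcup_{X\in M}V(X)$. Set $D=N_G(Q^x)$ and $R=\{z\in D: V(Q^x)\subseteq N_G(z)\}$. The structure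 records $S.M,S.U,S.D,S.R$. (iii) Build $\mathcal{C}^u$. Start with $\mathcal{C}^u=\emptyset$. Repeatedly pick some $Q\in\mathcal{Q}$ not belonging to $\bigcup_{X\in\mathcal{C}^u}X.M$ and add $S(u,Q)$ to $\mathcal{C}^u$. Stop when every member of $\mathcal{Q}$ lies in $\bigcup_{X\in\mathcal{C}^u}X.M$. Build $\mathcal{C}^v$ in the same way using $v$. Structures of $\mathcal{C}^u$ and of $\mathcal{C}^v$ are regarded as distinct objects. (iv) Form the graph $\Gamma$. Its vertex set is $\{X\in\mathcal{C}^u\cup\mathcal{C}^v: X.R\neq\emptyset\}$. Two distinct vertices $X,Y$ are adjacent if either they lie on the same side (both in $\mathcal{C}^u$ or both in $\mathcal{C}^v$), or $X\in\mathcal{C}^u$, $Y\in\mathcal{C}^v$, $X.M\cap Y.M=\emptyset$ and $(X.U\cup X.D)\cap(Y.U\cup Y.D)=\emptyset$. (v) Procedure Check_clique. Set $K=\emptyset$ and $V=V(\Gamma)$, and set flag to true if and only if $\mathcal{Q}\subseteq\bigcup_{X\in V}X.M$. While flag is true and $\mathcal{Q}\neq\bigl(\bigcup_{X\in\mathcal{C}^u\cap V}X.M\bigr)\cup\bigl(\bigcup_{X\in K}X.M\bigr)$, repeat the following: - add to $K$ every $X\in\mathcal{C}^v\cap V$ for which some $Q\in X.M$ does not belong to $\bigcup_{Y\in\mathcal{C}^u\cap V}Y.M$; - remove from $V$ every $X\in V$ for which there is some $Y\in K$ with $Y\neq X$ and $XY\notin E(\Gamma)$; - recompute flag as true if and only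 if $\mathcal{Q}\subseteq\bigcup_{X\in V}X.M$. If flag is true at the end of the loop, return YES. If no edge leads to YES, return NO. *)

theory Defs
  imports Main "HOL-Library.Extended_Nat" "HOL-Library.While_Combinator"
begin

definition graph :: "'a set \<Rightarrow> 'a set set \<Rightarrow> bool" where
  "graph V E \<longleftrightarrow> finite V \<and> (\<forall>e\<in>E. \<exists>a b. e = {a, b} \<and> a \<noteq> b \<and> a \<in> V \<and> b \<in> V)"

definition nbh :: "'a set set \<Rightarrow> 'a \<Rightarrow> 'a set" where
  "nbh E x = {y. {x, y} \<in> E \<and> y \<noteq> x}"

definition cnbh :: "'a set set \<Rightarrow> 'a \<Rightarrow> 'a set" where
  "cnbh E x = insert x (nbh E x)"

definition cnbh_set :: "'a set set \<Rightarrow> 'a set \<Rightarrow> 'a set" where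
  "cnbh_set E H = (\<Union>x\<in>H. cnbh E x)"

definition onbh_set :: "'a set set \<Rightarrow> 'a set \<Rightarrow> 'a set" where
  "onbh_set E H = cnbh_set E H - H"

definition is_walk :: "'a set set \<Rightarrow> 'a list \<Rightarrow> bool" where
  "is_walk E xs \<longleftrightarrow> xs \<noteq> [] \<and> (\<forall>i. Suc i < length xs \<longrightarrow> {xs ! i, xs ! Suc i} \<in> E \<and> xs ! i \<noteq> xs ! Suc i)"

definition walk_betw :: "'a set set \<Rightarrow> 'a \<Rightarrow> 'a \<Rightarrow> 'a list \<Rightarrow> bool" where
  "walk_betw E a b xs \<longleftrightarrow> is_walk E xs \<and> hd xs = a \<and> last xs = b"

text \<open>Shortest-path distance (infinity if no path).\<close>
definition dist :: "'a set set \<Rightarrow> 'a \<Rightarrow> 'a \<Rightarrow> enat" where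
  "dist E a b = (INF xs \<in> {xs. walk_betw E a b xs}. enat (length xs - 1))"

definition reach_in :: "'a set set \<Rightarrow> 'a set \<Rightarrow> 'a \<Rightarrow> 'a \<Rightarrow> bool" where
  "reach_in E S a b \<longleftrightarrow> (\<exists>xs. walk_betw E a b xs \<and> set xs \<subseteq> S)"

definition comps :: "'a set set \<Rightarrow> 'a set \<Rightarrow> 'a set set" where
  "comps E S = {{b \<in> S. reach_in E S a b} | a. a \<in> S}"

definition is_cycle :: "'a set set \<Rightarrow> 'a list \<Rightarrow> bool" where
  "is_cycle E xs \<longleftrightarrow> is_walk E xs \<and> length xs \<ge> 4 \<and> hd xs = last xs \<and> distinct (tl xs)"

definition is_tree :: "'a set \<Rightarrow> 'a set set \<Rightarrow> bool" where
  "is_tree V F \<longleftrightarrow> graph V F \<and> (\<forall>a\<in>V. \<forall>b\<in>V. reach_in F V a b) \<and> \<not> (\<exists>xs. is_cycle F xs)"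

definition tree_spanner :: "nat \<Rightarrow> 'a set \<Rightarrow> 'a set set \<Rightarrow> 'a set set \<Rightarrow> bool" where
  "tree_spanner t V E F \<longleftrightarrow> F \<subseteq> E \<and> is_tree V F \<and>
     (\<forall>a\<in>V. \<forall>b\<in>V. dist F a b \<le> enat t * dist E a b)"

definition diam_le :: "'a set \<Rightarrow> 'a set set \<Rightarrow> nat \<Rightarrow> bool" where
  "diam_le V F k \<longleftrightarrow> (\<forall>a\<in>V. \<forall>b\<in>V. dist F a b \<le> enat k)"

definition has_T3SD5 :: "'a set \<Rightarrow> 'a set set \<Rightarrow> bool" where
  "has_T3SD5 V E \<longleftrightarrow> (\<exists>F. tree_spanner 3 V E F \<and> diam_le V F 5)"

record 'a struc =
  sM :: "'a set set"
  sU :: "'a set"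
  sD :: "'a set"
  sR :: "'a set"

definition Qset :: "'a set \<Rightarrow> 'a set set \<Rightarrow> 'a \<Rightarrow> 'a \<Rightarrow> 'a set set" where
  "Qset V E u v = comps E (V - (cnbh E u \<union> cnbh E v))"

definition S :: "'a set \<Rightarrow> 'a set set \<Rightarrow> 'a \<Rightarrow> 'a \<Rightarrow> 'a \<Rightarrow> 'a set \<Rightarrow> 'a struc" where
  "S V E u v x Q =
    (let Qx = (THE C. C \<in> comps E (V - cnbh E x) \<and> Q \<subseteq> C);
         M = {X \<in> Qset V E u v. X \<subseteq> Qx};
         U = Qx - \<Union>M;
         D = onbh_set E Qx;
         R = {z \<in> D. Qx \<subseteq> nbh E z}
     in \<lparr>sM = M, sU = U, sD = D, sR = R\<rparr>)"

text \<open>A sequence of picked components qs is a valid run of the construction of \<C>^x: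
  each picked Q is in \<Q> and not yet covered by the previously added structures,
  and at the end every member of \<Q> is covered.\<close>
definition valid_constr :: "'a set \<Rightarrow> 'a set set \<Rightarrow> 'a \<Rightarrow> 'a \<Rightarrow> 'a \<Rightarrow> 'a set list \<Rightarrow> bool" where
  "valid_constr V E u v x qs \<longleftrightarrow>
     (\<forall>i < length qs. qs ! i \<in> Qset V E u v \<and>
         qs ! i \<notin> \<Union> (sM ` S V E u v x ` set (take i qs))) \<and>
     Qset V E u v \<subseteq> \<Union> (sM ` S V E u v x ` set qs)"

definition gamma_verts :: "'a struc set \<Rightarrow> 'a struc set \<Rightarrow> (bool \<times> 'a struc) set" where
  "gamma_verts Cu Cv = {(False, X) | X. X \<in> Cu \<and> sR X \<noteq> {}} \<union> {(True, X) | X. X \<in> Cv \<and> sR X \<noteq> {}}"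

definition cross_ok :: "'a struc \<Rightarrow> 'a struc \<Rightarrow> bool" where
  "cross_ok X Y \<longleftrightarrow> sM X \<inter> sM Y = {} \<and> (sU X \<union> sD X) \<inter> (sU Y \<union> sD Y) = {}"

definition gamma_adj :: "'a struc set \<Rightarrow> 'a struc set \<Rightarrow> bool \<times> 'a struc \<Rightarrow> bool \<times> 'a struc \<Rightarrow> bool" where
  "gamma_adj Cu Cv p q \<longleftrightarrow> p \<in> gamma_verts Cu Cv \<and> q \<in> gamma_verts Cu Cv \<and> p \<noteq> q \<and>
     (fst p = fst q \<or>
      (\<not> fst p \<and> fst q \<and> cross_ok (snd p) (snd q)) \<or>
      (fst p \<and> \<not> fst q \<and> cross_ok (snd q) (snd p)))"

definition covU :: "(bool \<times> 'a struc) set \<Rightarrow> 'a set set" where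
  "covU W = \<Union> {sM X | X. (False, X) \<in> W}"

definition covAll :: "(bool \<times> 'a struc) set \<Rightarrow> 'a set set" where
  "covAll W = \<Union> {sM X | s X. (s, X) \<in> W}"

definition cc_flag :: "'a set set \<Rightarrow> (bool \<times> 'a struc) set \<Rightarrow> bool" where
  "cc_flag Qs W \<longleftrightarrow> Qs \<subseteq> covAll W"

definition cc_cond :: "'a set set \<Rightarrow> (bool \<times> 'a struc) set \<times> (bool \<times> 'a struc) set \<Rightarrow> bool" where
  "cc_cond Qs st = (case st of (K, W) \<Rightarrow> cc_flag Qs W \<and> Qs \<noteq> covU W \<union> covAll K)"

definition cc_step :: "'a struc set \<Rightarrow> 'a struc set \<Rightarrow>
     (bool \<times> 'a struc) set \<times> (bool \<times> 'a struc) set \<Rightarrow> (bool \<times> 'a struc) set \<times> (bool \<times> 'a struc) set" where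
  "cc_step Cu Cv st = (case st of (K, W) \<Rightarrow>
     (let K' = K \<union> {(True, X) | X. (True, X) \<in> W \<and> (\<exists>Q\<in>sM X. Q \<notin> covU W)};
          W' = {p \<in> W. \<not> (\<exists>y\<in>K'. y \<noteq> p \<and> \<not> gamma_adj Cu Cv p y)}
      in (K', W')))"

definition check_clique :: "'a set set \<Rightarrow> 'a struc set \<Rightarrow> 'a struc set \<Rightarrow> bool" where
  "check_clique Qs Cu Cv =
     (case while_option (cc_cond Qs) (cc_step Cu Cv) ({}, gamma_verts Cu Cv) of
        Some (K, W) \<Rightarrow> cc_flag Qs W
      | None \<Rightarrow> False)"

definition edge_yes :: "'a set \<Rightarrow> 'a set set \<Rightarrow> 'a \<Rightarrow> 'a \<Rightarrow> 'a set list \<Rightarrow> 'a set list \<Rightarrow> bool" where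
  "edge_yes V E u v qsu qsv \<longleftrightarrow>
     Qset V E u v = {} \<or>
     check_clique (Qset V E u v) (S V E u v u ` set qsu) (S V E u v v ` set qsv)"

text \<open>A run: the list of examined edges, in order, each given as an ordered pair (u,v)
  together with the choice sequences used for \<C>^u and \<C>^v.\<close>
type_synonym 'a run = "('a \<times> 'a \<times> 'a set list \<times> 'a set list) list"

definition valid_run :: "'a set \<Rightarrow> 'a set set \<Rightarrow> 'a run \<Rightarrow> bool" where
  "valid_run V E r \<longleftrightarrow>
     distinct (map (\<lambda>(u, v, _, _). {u, v}) r) \<and>
     set (map (\<lambda>(u, v, _, _). {u, v}) r) = E \<and>
     (\<forall>(u, v, qsu, qsv) \<in> set r. u \<noteq> v \<and> valid_constr V E u v u qsu \<and> valid_constr V E u v v qsv)"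

fun run_edges :: "'a set \<Rightarrow> 'a set set \<Rightarrow> 'a run \<Rightarrow> bool" where
  "run_edges V E [] = False"
| "run_edges V E ((u, v, qsu, qsv) # r) = (if edge_yes V E u v qsu qsv then True else run_edges V E r)"

definition T3SD5 :: "'a set \<Rightarrow> 'a set set \<Rightarrow> 'a run \<Rightarrow> bool" where
  "T3SD5 V E r = (if E = {} then card V \<le> 1 else run_edges V E r)"

end

theory Submission
  imports Defs
begin

text \<open>
  A tree of diameter at most 5 has a central edge \<open>uv\<close>: every vertex is within distance 2 of
  \<open>u\<close> or \<open>v\<close>. In a tree 3-spanner with central edge \<open>uv\<close>, a vertex outside \<open>N[u]\<close> on the side
  of \<open>u\<close> is a grandchild of \<open>u\<close>, and its neighbours outside \<open>N[u]\<close> must have the same parent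
  (otherwise the stretch is at least 4). Hence a component of \<open>G - N[u]\<close> meeting \<open>\<Q>\<close> on that side
  hangs from one common neighbour, which lies in \<open>R\<close>, and its neighbourhood stays on the side of
  \<open>u\<close> or equals \<open>v\<close>. So the structures used by the spanner form a clique of \<open>\<Gamma>\<close> that covers
  \<open>\<Q>\<close>. Conversely, given a covering clique, hang each chosen component from a vertex of its \<open>R\<close>,
  attach each \<open>D\<close> to its own side and all remaining vertices of \<open>N[u,v]\<close> to \<open>u\<close> or \<open>v\<close>
  arbitrarily; the disjointness condition in \<open>\<Gamma>\<close> makes this consistent. Finally, the loop only
  puts into \<open>K\<close> structures which every covering clique inside the current vertex set contains, so
  it finds a covering clique whenever one exists.
\<close>

section \<open>Walks as relation powers\<close>

text \<open>As a symmetric relation, edges turn walks of length n into elements of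
  \<open>adj E ^^ n\<close> and reachability into a reflexive transitive closure.\<close>

definition adj :: "'a set set \<Rightarrow> ('a \<times> 'a) set" where
  "adj E = {(x, y). {x, y} \<in> E \<and> x \<noteq> y}"

lemma adj_iff: "(x, y) \<in> adj E \<longleftrightarrow> {x, y} \<in> E \<and> x \<noteq> y"
  by (simp add: adj_def)

lemma adj_sym: "(x, y) \<in> adj E \<longleftrightarrow> (y, x) \<in> adj E"
  by (auto simp: adj_def insert_commute)

lemma sym_adj: "sym (adj E)"
  by (auto intro!: symI simp: adj_sym)

lemma nbh_iff: "y \<in> nbh E x \<longleftrightarrow> (x, y) \<in> adj E"
  by (auto simp: nbh_def adj_def)

lemma graph_adjD: "graph V E \<Longrightarrow> (x, y) \<in> adj E \<Longrightarrow> x \<in> V \<and> y \<in> V"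
  by (fastforce simp: graph_def adj_def doubleton_eq_iff)

lemma is_walk_successively:
  "is_walk E xs \<longleftrightarrow> xs \<noteq> [] \<and> successively (\<lambda>x y. (x, y) \<in> adj E) xs"
  by (auto simp: is_walk_def successively_conv_nth adj_iff)

lemma walk_relpow: "walk_betw E a b xs \<Longrightarrow> (a, b) \<in> adj E ^^ (length xs - 1)"
proof (induction xs arbitrary: a rule: induct_list012)
  case (3 x y zs)
  then have "(x, y) \<in> adj E" "walk_betw E y b (y # zs)" "x = a"
    by (auto simp: walk_betw_def is_walk_successively)
  with 3(2)[of y] show ?case
    by (auto intro: relpow_Suc_I2 simp del: relpow.simps)
qed (auto simp: walk_betw_def is_walk_successively)

text \<open>\<open>A = UNIV\<close> gives the walks behind \<open>dist\<close>, general
  \<open>A\<close> those behind \<open>reach_in\<close>.\<close>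

lemma relpow_walk:
  "(a, b) \<in> (adj E \<inter> A \<times> A) ^^ n \<Longrightarrow> a \<in> A
    \<Longrightarrow> \<exists>xs. walk_betw E a b xs \<and> length xs = Suc n \<and> set xs \<subseteq> A"
proof (induction n arbitrary: a)
  case 0
  then show ?case
    by (intro exI[of _ "[a]"]) (auto simp: walk_betw_def is_walk_successively)
next
  case (Suc n)
  from Suc.prems(1) obtain c where c: "(a, c) \<in> adj E \<inter> A \<times> A" "(c, b) \<in> (adj E \<inter> A \<times> A) ^^ n"
    by (blast elim: relpow_Suc_E2)
  with Suc.IH[of c] obtain xs where "walk_betw E c b xs" "length xs = Suc n" "set xs \<subseteq> A"
    by auto
  with c Suc.prems(2) show ?case
    by (intro exI[of _ "a # xs"]) (auto simp: walk_betw_def is_walk_successively successively_Cons)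
qed

lemma dist_le_iff: "dist E a b \<le> enat n \<longleftrightarrow> (\<exists>m\<le>n. (a, b) \<in> adj E ^^ m)"
proof
  assume le: "dist E a b \<le> enat n"
  \<comment> \<open>An infimum of extended naturals is infinity on the empty set and attained
    otherwise, so a finite bound yields an actual walk.\<close>
  let ?L = "(\<lambda>xs. enat (length xs - 1)) ` {xs. walk_betw E a b xs}"
  have ne: "?L \<noteq> {}"
  proof
    assume e: "?L = {}"
    have "dist E a b = \<infinity>" unfolding dist_def e by (simp add: Inf_enat_def)
    with le show False by simp
  qed
  then obtain x where "x \<in> ?L" by blast
  from LeastI[of "\<lambda>x. x \<in> ?L", OF this] ne have "Inf ?L \<in> ?L"
    by (simp add: Inf_enat_def)
  then obtain xs where "walk_betw E a b xs" "dist E a b = enat (length xs - 1)"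
    by (auto simp: dist_def)
  with le walk_relpow[of E a b xs] show "\<exists>m\<le>n. (a, b) \<in> adj E ^^ m"
    by auto
next
  assume "\<exists>m\<le>n. (a, b) \<in> adj E ^^ m"
  then obtain m where m: "m \<le> n" "(a, b) \<in> adj E ^^ m" by blast
  then obtain xs where "walk_betw E a b xs" "length xs = Suc m"
    using relpow_walk[of a b m E UNIV] by auto
  then have "dist E a b \<le> enat m"
    unfolding dist_def by (intro INF_lower2[of xs]) auto
  also have "\<dots> \<le> enat n" using m by simp
  finally show "dist E a b \<le> enat n" .
qed

lemma reach_in_iff: "reach_in E A a b \<longleftrightarrow> a \<in> A \<and> (a, b) \<in> (adj E \<inter> A \<times> A)\<^sup>*"
proof
  assume "reach_in E A a b"
  then obtain xs where "walk_betw E a b xs" "set xs \<subseteq> A"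
    by (auto simp: reach_in_def)
  then show "a \<in> A \<and> (a, b) \<in> (adj E \<inter> A \<times> A)\<^sup>*"
  proof (induction xs arbitrary: a rule: induct_list012)
    case (3 x y zs)
    then have "(x, y) \<in> adj E \<inter> A \<times> A" "walk_betw E y b (y # zs)" "x = a"
      by (auto simp: walk_betw_def is_walk_successively)
    with 3(2)[of y] 3(4) show ?case
      by (auto intro: converse_rtrancl_into_rtrancl)
  qed (auto simp: walk_betw_def is_walk_successively)
next
  assume "a \<in> A \<and> (a, b) \<in> (adj E \<inter> A \<times> A)\<^sup>*"
  then show "reach_in E A a b"
    using relpow_walk[where A = A] by (fastforce simp: reach_in_def rtrancl_power)
qed

section \<open>Trees\<close>

text \<open>A shortest walk from \<open>u\<close> to \<open>v\<close> that avoids the edge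
  \<open>uv\<close> repeats no vertex, and prefixing \<open>v\<close> closes it into a
  cycle.\<close>

lemma acyclic_bridge:
  assumes "\<not> (\<exists>xs. is_cycle F xs)" and "(u, v) \<in> adj F"
  shows "(u, v) \<notin> (adj (F - {{u, v}}))\<^sup>*"
proof
  let ?F = "F - {{u, v}}"
  assume "(u, v) \<in> (adj ?F)\<^sup>*"
  then have ex: "\<exists>xs. walk_betw ?F u v xs"
    using reach_in_iff[of ?F UNIV u v] by (auto simp: reach_in_def)
  define xs where "xs = (ARG_MIN length xs. walk_betw ?F u v xs)"
  have w: "walk_betw ?F u v xs" and
    least: "\<And>ys. walk_betw ?F u v ys \<Longrightarrow> length xs \<le> length ys"
    using ex arg_min_nat_lemma[of "walk_betw ?F u v" _ length] unfolding xs_def by blast+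
  have dist: "distinct xs"
  proof (rule ccontr)
    assume "\<not> distinct xs"
    then obtain as bs cs x where xs: "xs = as @ [x] @ bs @ [x] @ cs"
      using not_distinct_decomp by blast
    have "walk_betw ?F u v (as @ [x] @ cs)"
      using w unfolding xs walk_betw_def is_walk_successively
      by (auto simp: successively_append_iff successively_Cons hd_append split: if_splits)
    from least[OF this] show False
      by (simp add: xs)
  qed
  obtain ys where xs: "xs = u # ys" and "last xs = v"
    using w by (cases xs) (auto simp: walk_betw_def is_walk_def)
  moreover have "u \<noteq> v" using assms(2) by (simp add: adj_iff)
  ultimately obtain y zs where xs: "xs = u # y # zs"
    by (cases ys) auto
  \<comment> \<open>Avoiding the edge \<open>uv\<close> forces an inner vertex, so the closed list
    has the four entries that \<open>is_cycle\<close> demands.\<close>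
  have "y \<noteq> v"
    using w xs by (auto simp: walk_betw_def is_walk_successively adj_iff)
  with w xs have "zs \<noteq> []" by (auto simp: walk_betw_def)
  have sub: "adj ?F \<subseteq> adj F" by (auto simp: adj_def)
  have succ: "successively (\<lambda>x y. (x, y) \<in> adj F) xs"
    using w sub by (auto simp: walk_betw_def is_walk_successively elim!: successively_mono)
  have "is_cycle F (v # xs)"
    using succ \<open>zs \<noteq> []\<close> dist w assms(2) unfolding is_cycle_def is_walk_successively
    by (cases zs) (auto simp: xs walk_betw_def adj_sym)
  with assms(1) show False by blast
qed

section \<open>The two sides of a tree edge, and distances across it\<close>

definition side :: "'a set set \<Rightarrow> 'a \<Rightarrow> 'a \<Rightarrow> 'a set" where
  "side F u v = {z. (u, z) \<in> (adj (F - {{u, v}}))\<^sup>*}"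

text \<open>Natural-number distances let linear arithmetic add and subtract bounds; the value is
  meaningful only for connected vertices.\<close>

definition ndist :: "'a set set \<Rightarrow> 'a \<Rightarrow> 'a \<Rightarrow> nat" where
  "ndist F a b = (LEAST n. (a, b) \<in> adj F ^^ n)"

lemma ndist_le: "(a, b) \<in> adj F ^^ n \<Longrightarrow> ndist F a b \<le> n"
  unfolding ndist_def by (rule Least_le)

lemma side_self: "u \<in> side F u v"
  by (simp add: side_def)

lemma side_step:
  "x \<in> side F u v \<Longrightarrow> (x, y) \<in> adj F \<Longrightarrow> {x, y} \<noteq> {u, v} \<Longrightarrow> y \<in> side F u v"
  unfolding side_def mem_Collect_eq by (erule rtrancl_into_rtrancl) (simp add: adj_iff)

lemma relpow_adj_sym: "(a, b) \<in> adj F ^^ n \<Longrightarrow> (b, a) \<in> adj F ^^ n"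
proof (induction n arbitrary: b)
  case (Suc n)
  then show ?case
    by (meson adj_sym relpow_Suc_E relpow_Suc_I2)
qed auto

locale tree =
  fixes V :: "'a set" and F :: "'a set set"
  assumes tree: "is_tree V F"
begin

lemma adj_V: "(x, y) \<in> adj F \<Longrightarrow> x \<in> V \<and> y \<in> V"
  using tree graph_adjD unfolding is_tree_def by metis

lemma connected: "a \<in> V \<Longrightarrow> b \<in> V \<Longrightarrow> (a, b) \<in> (adj F)\<^sup>*"
  using tree rtrancl_mono[of "adj F \<inter> V \<times> V" "adj F"] by (auto simp: is_tree_def reach_in_iff)

lemma ndist_relpow: "a \<in> V \<Longrightarrow> b \<in> V \<Longrightarrow> (a, b) \<in> adj F ^^ ndist F a b"
  unfolding ndist_def using connected[of a b] by (auto simp: rtrancl_power intro: LeastI)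

lemma ndist_sym: "a \<in> V \<Longrightarrow> b \<in> V \<Longrightarrow> ndist F a b = ndist F b a"
  by (meson ndist_le ndist_relpow le_antisym relpow_adj_sym)

lemma ndist_triangle: "a \<in> V \<Longrightarrow> b \<in> V \<Longrightarrow> c \<in> V \<Longrightarrow> ndist F a c \<le> ndist F a b + ndist F b c"
  by (meson ndist_le ndist_relpow relpow_trans)

lemma ndist_le_iff: "a \<in> V \<Longrightarrow> b \<in> V \<Longrightarrow> ndist F a b \<le> n \<longleftrightarrow> dist F a b \<le> enat n"
  by (meson dist_le_iff ndist_le ndist_relpow le_trans)

lemma ndist_0: "a \<in> V \<Longrightarrow> b \<in> V \<Longrightarrow> ndist F a b = 0 \<Longrightarrow> a = b"
  using ndist_relpow[of a b] by simp

lemma ndist_self [simp]: "ndist F a a = 0"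
  using ndist_le[of a a 0 F] by simp

lemma ndist_adj: "(a, b) \<in> adj F \<Longrightarrow> ndist F a b \<le> 1"
  by (rule ndist_le) simp

lemma bridge: "(u, v) \<in> adj F \<Longrightarrow> v \<notin> side F u v"
  using acyclic_bridge[of F u v] tree by (auto simp: side_def is_tree_def)

lemma side_cover:
  assumes "(u, v) \<in> adj F" "z \<in> V"
  shows "z \<in> side F u v \<or> z \<in> side F v u"
proof -
  have "(u, z) \<in> (adj F)\<^sup>*"
    using assms connected adj_V by blast
  then show ?thesis
  proof (induction rule: rtrancl_induct)
    case (step y z)
    then show ?case
      using side_step[of y F u v z] side_step[of y F v u z] side_self[of u F v] side_self[of v F u]
      by (auto simp: doubleton_eq_iff)
  qed (simp add: side_self)
qed

lemma side_disjoint: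
  assumes "(u, v) \<in> adj F" "z \<in> side F u v" shows "z \<notin> side F v u"
proof
  assume "z \<in> side F v u"
  then have "(z, v) \<in> (adj (F - {{u, v}}))\<^sup>*"
    using symD[OF sym_rtrancl[OF sym_adj]] by (fastforce simp: side_def insert_commute)
  with assms have "v \<in> side F u v"
    by (auto simp: side_def)
  with bridge assms show False by blast
qed

lemma side_exit:
  assumes "(u, v) \<in> adj F" "(x, y) \<in> adj F" "x \<in> side F u v" "y \<notin> side F u v"
  shows "x = u \<and> y = v"
  using side_step[of x F u v y] bridge[of u v] assms by (auto simp: doubleton_eq_iff)

text \<open>Every walk from \<open>z\<close> to \<open>y\<close> leaves the side of
  \<open>u\<close>, and the only exit is the step from \<open>u\<close> to \<open>v\<close>; the
  induction follows the walk to that exit.\<close>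

lemma ndist_cross:
  assumes uv: "(u, v) \<in> adj F" and "z \<in> V" "y \<in> V" "z \<in> side F u v" "y \<in> side F v u"
  shows "ndist F z u + 1 + ndist F v y \<le> ndist F z y"
proof -
  have y: "y \<notin> side F u v"
    using side_disjoint assms by blast
  have "ndist F z u + 1 + ndist F v y \<le> n" if "(z, y) \<in> adj F ^^ n" "z \<in> side F u v" for n z
    using that
  proof (induction n arbitrary: z)
    case (Suc n)
    then obtain c where c: "(z, c) \<in> adj F" "(c, y) \<in> adj F ^^ n"
      by (blast elim: relpow_Suc_E2)
    show ?case
    proof (cases "c \<in> side F u v")
      case True
      have "ndist F z u \<le> ndist F z c + ndist F c u"
        using ndist_triangle adj_V uv c by blast
      with Suc.IH[OF c(2) True] ndist_adj[OF c(1)] show ?thesis by linarith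
    next
      case False
      then have "z = u \<and> c = v" using side_exit uv c Suc by blast
      with ndist_le[OF c(2)] show ?thesis by auto
    qed
  qed (use y in auto)
  with ndist_relpow assms show ?thesis by blast
qed

lemma ndist_cross_end:
  assumes "(u, v) \<in> adj F" and "z \<in> V" "z \<in> side F u v"
  shows "ndist F z u < ndist F z v"
  using ndist_cross[of u v z v] assms adj_V side_self[of v F u] by auto

text \<open>If some \<open>z\<close> is still farther than \<open>k\<close> from both ends, say on
  the side of \<open>u\<close>, the edge moves one step towards \<open>z\<close>, from
  \<open>uv\<close> to \<open>uw\<close>. Vertices on the sides of both \<open>u\<close> and
  \<open>w\<close> gain one unit; for all others the diameter bound against the distant
  \<open>z\<close> leaves a distance to \<open>u\<close> of at most \<open>4 - k\<close>, hence at
  most \<open>k\<close>.\<close>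

lemma central_edge_step:
  assumes diam: "\<And>a b. a \<in> V \<Longrightarrow> b \<in> V \<Longrightarrow> ndist F a b \<le> 5"
    and uv: "(u, v) \<in> adj F" and k: "2 \<le> k"
    and near: "\<And>t. t \<in> V \<Longrightarrow> ndist F t u \<le> Suc k \<or> ndist F t v \<le> Suc k"
  shows "\<exists>u v. (u, v) \<in> adj F \<and> (\<forall>t\<in>V. ndist F t u \<le> k \<or> ndist F t v \<le> k)"
proof (cases "\<forall>t\<in>V. ndist F t u \<le> k \<or> ndist F t v \<le> k")
  case True
  then show ?thesis using uv by blast
next
  case False
  then obtain z where z: "z \<in> V" "k < ndist F z u" "k < ndist F z v"
    by (auto simp: not_le)
  \<comment> \<open>Stated for an arbitrary edge so that it serves \<open>uv\<close> and
    \<open>vu\<close> alike, whichever side contains \<open>z\<close>.\<close>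
  have "\<exists>u v. (u, v) \<in> adj F \<and> (\<forall>t\<in>V. ndist F t u \<le> k \<or> ndist F t v \<le> k)"
    if uv: "(u, v) \<in> adj F" and zs: "z \<in> side F u v" and zu: "k < ndist F z u"
      and near: "\<And>t. t \<in> V \<Longrightarrow> ndist F t u \<le> Suc k \<or> ndist F t v \<le> Suc k" for u v
  proof -
    have V: "u \<in> V" "v \<in> V" using uv adj_V by auto
    obtain n where n: "ndist F u z = Suc n"
      using zu ndist_sym[of u z] V z by (cases "ndist F u z") auto
    then obtain w where w: "(u, w) \<in> adj F" "(w, z) \<in> adj F ^^ n"
      using ndist_relpow[of u z] V z by (metis relpow_Suc_E2)
    have wV: "w \<in> V" using w adj_V by auto
    have wz: "ndist F z w < ndist F z u"
      using ndist_le[OF w(2)] n V z wV by (simp add: ndist_sym)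
    have wu: "(w, u) \<in> adj F" using w adj_sym by fast
    have "z \<notin> side F u w"
      using ndist_cross_end[of u w z] w wz z by auto
    then have zw: "z \<in> side F w u" using side_cover w z by blast
    have "ndist F t u \<le> k \<or> ndist F t w \<le> k" if t: "t \<in> V" for t
    proof (cases "t \<in> side F u w")
      case True
      have "ndist F z w + 1 + ndist F u t \<le> 5"
        using ndist_cross[OF wu z(1) t zw True] diam[of z t] z t by linarith
      moreover have "ndist F z u \<le> ndist F z w + ndist F w u"
        using ndist_triangle z wV V by blast
      ultimately have "ndist F u t \<le> k"
        using zu k ndist_adj[OF wu] by linarith
      then show ?thesis using ndist_sym t V by auto
    next
      case False
      then have "t \<in> side F w u" using side_cover w t by blast
      then have tw: "ndist F t w < ndist F t u" using ndist_cross_end wu t by blast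
      show ?thesis
      proof (cases "t \<in> side F u v")
        case True
        then have "ndist F t u < ndist F t v" using ndist_cross_end uv t by blast
        with near[OF t] tw show ?thesis by linarith
      next
        case False
        then have "t \<in> side F v u" using side_cover uv t by blast
        then have "ndist F z u + 1 + ndist F v t \<le> 5"
          using ndist_cross[OF uv z(1) t zs] diam[of z t] z t by linarith
        moreover have "ndist F t u \<le> ndist F t v + ndist F v u"
          using ndist_triangle t V by blast
        moreover have "ndist F v u \<le> 1" using uv adj_sym ndist_adj by fast
        moreover have "ndist F v t = ndist F t v" using ndist_sym t V by blast
        ultimately show ?thesis using zu k by linarith
      qed
    qed
    then show ?thesis using w by blast
  qed
  note goal = this
  show ?thesis
  proof (cases "z \<in> side F u v")
    case True
    then show ?thesis using goal[OF uv] near z by blast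
  next
    case False
    then have "z \<in> side F v u" using side_cover uv z by blast
    moreover have "(v, u) \<in> adj F" using uv adj_sym by fast
    ultimately show ?thesis using goal[of v u] near z by blast
  qed
qed

text \<open>Any edge has radius 5 by the diameter bound, and three central-edge steps lower this to
  2; hence the induction downwards from \<open>k = 3\<close>.\<close>

lemma central_edge:
  assumes diam: "\<And>a b. a \<in> V \<Longrightarrow> b \<in> V \<Longrightarrow> ndist F a b \<le> 5" and "(a, b) \<in> adj F"
  shows "\<exists>u v. (u, v) \<in> adj F \<and> (\<forall>t\<in>V. ndist F t u \<le> 2 \<or> ndist F t v \<le> 2)"
proof -
  have "\<exists>u v. (u, v) \<in> adj F \<and> (\<forall>t\<in>V. ndist F t u \<le> 2 + k \<or> ndist F t v \<le> 2 + k)" if "k \<le> 3" for k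
    using that
  proof (induction rule: inc_induct)
    case base
    show ?case using diam adj_V[OF assms(2)] assms(2) by (intro exI[of _ a] exI[of _ b]) auto
  next
    case (step k)
    then show ?case using central_edge_step[OF diam, of _ _ "2 + k"] by auto
  qed
  from this[of 0] show ?thesis by simp
qed

end

section \<open>Components\<close>

lemma comps_iff:
  "C \<in> comps E A \<longleftrightarrow> (\<exists>a\<in>A. C = {b. (a, b) \<in> (adj E \<inter> A \<times> A)\<^sup>*})"
proof -
  have "b \<in> A" if "a \<in> A" "(a, b) \<in> (adj E \<inter> A \<times> A)\<^sup>*" for a b
    using that(2,1) by (induction rule: rtrancl_induct) auto
  then have "{b \<in> A. reach_in E A a b} = {b. (a, b) \<in> (adj E \<inter> A \<times> A)\<^sup>*}" if "a \<in> A" for a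
    using that by (auto simp: reach_in_iff)
  then show ?thesis
    by (auto simp: comps_def)
qed

lemma comps_subset: "C \<in> comps E A \<Longrightarrow> C \<subseteq> A"
  by (auto simp: comps_def)

lemma comps_nonempty: "C \<in> comps E A \<Longrightarrow> C \<noteq> {}"
  by (auto simp: comps_iff)

lemma comps_cover: "a \<in> A \<Longrightarrow> \<exists>C\<in>comps E A. a \<in> C"
  unfolding Bex_def comps_iff by blast

lemma comps_reach:
  assumes "C \<in> comps E A" "x \<in> C"
  shows "C = {y. (x, y) \<in> (adj E \<inter> A \<times> A)\<^sup>*}"
proof -
  obtain a where C: "C = {b. (a, b) \<in> (adj E \<inter> A \<times> A)\<^sup>*}"
    using assms by (auto simp: comps_iff)
  have "sym (adj E \<inter> A \<times> A)"
    by (auto intro!: symI simp: adj_sym)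
  then have "(x, a) \<in> (adj E \<inter> A \<times> A)\<^sup>*"
    using assms C by (auto intro: symD[OF sym_rtrancl])
  with assms C show ?thesis
    by (auto intro: rtrancl_trans)
qed

lemma comps_eq: "C \<in> comps E A \<Longrightarrow> C' \<in> comps E A \<Longrightarrow> x \<in> C \<Longrightarrow> x \<in> C' \<Longrightarrow> C = C'"
  using comps_reach[of C E A x] comps_reach[of C' E A x] by simp

lemma comps_step:
  assumes "C \<in> comps E A" "x \<in> C" "(x, y) \<in> adj E" "y \<in> A"
  shows "y \<in> C"
  using comps_reach[OF assms(1,2)] comps_subset[OF assms(1)] assms by auto

text \<open>Carries a property through a component along its edges, as needed to give all its
  vertices one common parent.\<close>

lemma comps_induct [consumes 3, case_names step]:
  assumes "C \<in> comps E A" "x \<in> C" "P x"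
    and step: "\<And>y z. y \<in> C \<Longrightarrow> P y \<Longrightarrow> (y, z) \<in> adj E \<Longrightarrow> z \<in> A \<Longrightarrow> P z"
  shows "\<forall>y\<in>C. P y"
proof
  fix y assume "y \<in> C"
  then have "(x, y) \<in> (adj E \<inter> A \<times> A)\<^sup>*"
    using comps_reach[OF assms(1,2)] by simp
  then show "P y"
  proof (induction rule: rtrancl_induct)
    case (step y z)
    then have "y \<in> C" using comps_reach[OF assms(1,2)] by simp
    with step assms(4) show ?case by blast
  qed (rule assms(3))
qed

text \<open>Uniqueness makes the description \<open>THE\<close> in the definition of
  \<open>S\<close> denote the intended component.\<close>

lemma comps_mono:
  assumes "C \<in> comps E A" "A \<subseteq> B"
  shows "\<exists>!C'. C' \<in> comps E B \<and> C \<subseteq> C'"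
proof -
  obtain x where x: "x \<in> C" using comps_nonempty[OF assms(1)] by blast
  then obtain C' where C': "C' \<in> comps E B" "x \<in> C'"
    using comps_cover comps_subset assms by (metis subsetD)
  have "adj E \<inter> A \<times> A \<subseteq> adj E \<inter> B \<times> B" using assms(2) by blast
  from rtrancl_mono[OF this] have "C \<subseteq> C'"
    using comps_reach[OF C'] comps_reach[OF assms(1) x] by blast
  with C' x show ?thesis
    by (metis comps_eq subsetD)
qed

text \<open>\<open>outer_comp V E x Q\<close> is the component \<open>Q\<^sup>x\<close> of the algorithm.\<close>
definition outer_comp :: "'a set \<Rightarrow> 'a set set \<Rightarrow> 'a \<Rightarrow> 'a set \<Rightarrow> 'a set" where
  "outer_comp V E x Q = (THE C. C \<in> comps E (V - cnbh E x) \<and> Q \<subseteq> C)"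

section \<open>Structures of the algorithm in terms of outer components\<close>

lemma S_simps:
  "sM (S V E u v x Q) = {X \<in> Qset V E u v. X \<subseteq> outer_comp V E x Q}"
  "sU (S V E u v x Q) = outer_comp V E x Q - \<Union>{X \<in> Qset V E u v. X \<subseteq> outer_comp V E x Q}"
  "sD (S V E u v x Q) = onbh_set E (outer_comp V E x Q)"
  "sR (S V E u v x Q) = {z \<in> onbh_set E (outer_comp V E x Q). outer_comp V E x Q \<subseteq> nbh E z}"
  by (simp_all add: S_def outer_comp_def Let_def)

lemma S_cong: "outer_comp V E x Q = outer_comp V E x Q' \<Longrightarrow> S V E u v x Q = S V E u v x Q'"
  by (simp add: S_def outer_comp_def Let_def)

lemma Qset_commute: "Qset V E u v = Qset V E v u"
  by (simp add: Qset_def Un_commute)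

lemma onbh_set_iff: "y \<in> onbh_set E C \<longleftrightarrow> y \<notin> C \<and> (\<exists>x\<in>C. (x, y) \<in> adj E)"
  by (auto simp: onbh_set_def cnbh_set_def cnbh_def nbh_iff)

lemma cnbh_iff: "y \<in> cnbh E x \<longleftrightarrow> y = x \<or> (x, y) \<in> adj E"
  by (auto simp: cnbh_def nbh_iff)

text \<open>Leaving \<open>x\<close> open between \<open>u\<close> and \<open>v\<close> treats the
  structures of both sides at once.\<close>

locale edge_structures =
  fixes V :: "'a set" and E :: "'a set set" and u v x :: 'a
  assumes graph: "graph V E" and x: "x = u \<or> x = v"
begin

abbreviation "\<Q> \<equiv> Qset V E u v"

lemma outer_comp_comps:
  assumes "Q \<in> \<Q>"
  shows "outer_comp V E x Q \<in> comps E (V - cnbh E x)" "Q \<subseteq> outer_comp V E x Q"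
proof -
  have "V - (cnbh E u \<union> cnbh E v) \<subseteq> V - cnbh E x" using x by auto
  from theI'[OF comps_mono[OF assms[unfolded Qset_def] this]]
  show "outer_comp V E x Q \<in> comps E (V - cnbh E x)" "Q \<subseteq> outer_comp V E x Q"
    by (simp_all add: outer_comp_def)
qed

lemma outer_comp_eq:
  assumes "Q \<in> \<Q>" "Q' \<in> \<Q>" "Q' \<subseteq> outer_comp V E x Q"
  shows "outer_comp V E x Q' = outer_comp V E x Q"
proof -
  obtain z where "z \<in> Q'" using comps_nonempty assms(2) unfolding Qset_def by blast
  then show ?thesis
    using comps_eq[OF outer_comp_comps(1) outer_comp_comps(1), OF assms(2,1), of z] outer_comp_comps(2)[OF assms(2)] assms(3)
    by blast
qed

lemma Q_in_sM: "Q \<in> \<Q> \<Longrightarrow> Q \<in> sM (S V E u v x Q)"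
  using outer_comp_comps by (auto simp: S_simps)

text \<open>Outer components sharing a member of \<Q> coincide, so every covered component
  determines the whole structure.\<close>

lemma S_eq_if_sM:
  "Q \<in> \<Q> \<Longrightarrow> Q' \<in> sM (S V E u v x Q) \<Longrightarrow> S V E u v x Q' = S V E u v x Q"
  using outer_comp_eq S_cong by (auto simp: S_simps)

lemma outer_comp_not_cnbh: "Q \<in> \<Q> \<Longrightarrow> z \<in> outer_comp V E x Q \<Longrightarrow> z \<in> V \<and> z \<noteq> x \<and> (x, z) \<notin> adj E"
  using comps_subset[OF outer_comp_comps(1), of Q] by (auto simp: cnbh_iff)

lemma outer_comp_step:
  assumes "Q \<in> \<Q>" "z \<in> outer_comp V E x Q" "(z, y) \<in> adj E"
  shows "y \<in> outer_comp V E x Q \<or> (x, y) \<in> adj E \<and> y \<in> onbh_set E (outer_comp V E x Q)"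
proof (cases "y \<in> outer_comp V E x Q")
  case False
  then have "y \<in> cnbh E x"
    using comps_step[OF outer_comp_comps(1)] assms graph_adjD[OF graph] by blast
  then show ?thesis
    using outer_comp_not_cnbh[OF assms(1,2)] assms False
    by (auto simp: cnbh_iff onbh_set_iff adj_sym)
qed auto

lemma onbh_outer_comp: "Q \<in> \<Q> \<Longrightarrow> y \<in> onbh_set E (outer_comp V E x Q) \<Longrightarrow> (x, y) \<in> adj E"
  using outer_comp_step by (auto simp: onbh_set_iff)

lemma outer_comp_conv: "Q \<in> \<Q> \<Longrightarrow> outer_comp V E x Q = \<Union>(sM (S V E u v x Q)) \<union> sU (S V E u v x Q)"
  by (auto simp: S_simps)

text \<open>A vertex of the outer component outside \<open>N[u,v]\<close> lies in some member of
  \<Q> with the same outer component, so \<open>sM\<close> covers it and it is missing from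
  \<open>sU\<close>.\<close>

lemma sU_near:
  assumes "Q \<in> \<Q>" "z \<in> sU (S V E u v x Q)"
  shows "z \<in> cnbh E u \<union> cnbh E v"
proof (rule ccontr)
  assume "\<not> ?thesis"
  moreover have z: "z \<in> outer_comp V E x Q" using assms(2) by (simp add: S_simps)
  ultimately have "z \<in> V - (cnbh E u \<union> cnbh E v)"
    using outer_comp_not_cnbh[OF assms(1)] by blast
  from comps_cover[OF this, of E] obtain Q' where Q': "Q' \<in> \<Q>" "z \<in> Q'"
    unfolding Qset_def by blast
  with z have "outer_comp V E x Q' = outer_comp V E x Q"
    using comps_eq[OF outer_comp_comps(1) outer_comp_comps(1), OF Q'(1) assms(1), of z] outer_comp_comps(2)[OF Q'(1)]
    by blast
  with Q' outer_comp_comps(2)[OF Q'(1)] assms(2) show False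
    by (auto simp: S_simps)
qed

end

lemma Qset_far: "Q \<in> Qset V E u v \<Longrightarrow> z \<in> Q \<Longrightarrow> z \<in> V \<and> z \<notin> cnbh E u \<and> z \<notin> cnbh E v"
  using comps_subset[of Q E] unfolding Qset_def by blast

section \<open>The clique search\<close>

text \<open>The loop-free counterpart of \<open>check_clique\<close>: soundness produces such a set
  and completeness starts from one.\<close>

definition covering_clique ::
  "'a set set \<Rightarrow> 'a struc set \<Rightarrow> 'a struc set \<Rightarrow> (bool \<times> 'a struc) set \<Rightarrow> bool" where
  "covering_clique Qs Cu Cv W \<longleftrightarrow> W \<subseteq> gamma_verts Cu Cv \<and>
     (\<forall>p\<in>W. \<forall>q\<in>W. p \<noteq> q \<longrightarrow> gamma_adj Cu Cv p q) \<and> Qs \<subseteq> covAll W"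

lemma gamma_verts_iff:
  "(s, X) \<in> gamma_verts Cu Cv \<longleftrightarrow> X \<in> (if s then Cv else Cu) \<and> sR X \<noteq> {}"
  by (auto simp: gamma_verts_def)

lemma covAll_iff: "Q \<in> covAll W \<longleftrightarrow> (\<exists>s X. (s, X) \<in> W \<and> Q \<in> sM X)"
  by (auto simp: covAll_def)

lemma covU_iff: "Q \<in> covU W \<longleftrightarrow> (\<exists>X. (False, X) \<in> W \<and> Q \<in> sM X)"
  by (auto simp: covU_def)

lemma gamma_adj_sym: "gamma_adj Cu Cv p q \<longleftrightarrow> gamma_adj Cu Cv q p"
  by (auto simp: gamma_adj_def)

text \<open>When the loop stops with the flag up, the \<open>u\<close>-side of \<open>W\<close>
  together with \<open>K\<close> covers \<open>Qs\<close>. Vertices on one side are adjacent by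
  definition; across the sides, adjacency comes from pruning \<open>W\<close> against
  \<open>K\<close>.\<close>

lemma check_clique_sound:
  assumes "check_clique Qs Cu Cv"
  shows "\<exists>W. covering_clique Qs Cu Cv W"
proof -
  let ?G = "gamma_verts Cu Cv"
  obtain K W where while: "while_option (cc_cond Qs) (cc_step Cu Cv) ({}, ?G) = Some (K, W)"
    and flag: "cc_flag Qs W"
    using assms by (auto simp: check_clique_def split: option.splits)
  \<comment> \<open>Invariant: \<open>K\<close> holds only \<open>v\<close>-side vertices, and
    whatever remains in \<open>W\<close> is compatible with all of \<open>K\<close>.\<close>
  define I where "I = (\<lambda>(K, W). W \<subseteq> ?G \<and> K \<subseteq> ?G \<and> fst ` K \<subseteq> {True} \<and>
    (\<forall>p\<in>W. \<forall>y\<in>K. y \<noteq> p \<longrightarrow> gamma_adj Cu Cv p y))"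
  have step: "I (cc_step Cu Cv st)" if "I st" for st
  proof -
    obtain K W where st: "st = (K, W)" by fastforce
    define K' where "K' = K \<union> {(True, X) | X. (True, X) \<in> W \<and> (\<exists>Q\<in>sM X. Q \<notin> covU W)}"
    have "K' \<subseteq> ?G" "fst ` K' \<subseteq> {True}"
      using that by (auto simp: K'_def I_def st)
    with that show ?thesis
      unfolding st cc_step_def Let_def prod.case K'_def[symmetric] by (auto simp: I_def)
  qed
  have "I (K, W)"
    by (rule while_option_rule[OF _ while, of I]) (use step in \<open>auto simp: I_def\<close>)
  moreover have "Qs = covU W \<union> covAll K"
    using while_option_stop[OF while] flag by (simp add: cc_cond_def)
  moreover have "gamma_adj Cu Cv p q"
    if "I (K, W)" "p \<in> {p \<in> W. \<not> fst p} \<union> K" "q \<in> {p \<in> W. \<not> fst p} \<union> K" "p \<noteq> q" for p q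
  proof (cases "fst p = fst q")
    case True
    then show ?thesis using that by (auto simp: gamma_adj_def I_def)
  next
    case False
    then have "p \<in> W \<and> q \<in> K \<or> p \<in> K \<and> q \<in> W" using that by (auto simp: I_def)
    then show ?thesis using that gamma_adj_sym[of Cu Cv p q] by (auto simp: I_def)
  qed
  moreover have "covU W \<union> covAll K \<subseteq> covAll ({p \<in> W. \<not> fst p} \<union> K)"
    by (fastforce simp: covAll_iff covU_iff)
  ultimately have "covering_clique Qs Cu Cv ({p \<in> W. \<not> fst p} \<union> K)"
    unfolding covering_clique_def by (auto simp: I_def)
  then show ?thesis by blast
qed

text \<open>A component that the \<open>u\<close>-side of \<open>W\<close> misses must be covered by
  \<open>C\<close> from the \<open>v\<close>-side, and by \<open>disj\<close> only one
  \<open>v\<close>-structure contains it. So all members of \<open>K\<close> are forced to be in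
  \<open>C\<close>, and pruning never removes a member of \<open>C\<close>.\<close>

lemma check_clique_complete:
  assumes fin: "finite Cu" "finite Cv"
    and sub: "\<And>X. X \<in> Cu \<union> Cv \<Longrightarrow> sM X \<subseteq> Qs"
    and disj: "\<And>X Y Q. X \<in> Cv \<Longrightarrow> Y \<in> Cv \<Longrightarrow> Q \<in> sM X \<Longrightarrow> Q \<in> sM Y \<Longrightarrow> X = Y"
    and clique: "covering_clique Qs Cu Cv C"
  shows "check_clique Qs Cu Cv"
proof -
  let ?G = "gamma_verts Cu Cv"
  define I where "I = (\<lambda>(K, W). K \<subseteq> C \<and> C \<subseteq> W \<and> W \<subseteq> ?G)"
  have C: "C \<subseteq> ?G" "\<And>p q. p \<in> C \<Longrightarrow> q \<in> C \<Longrightarrow> p \<noteq> q \<Longrightarrow> gamma_adj Cu Cv p q" "Qs \<subseteq> covAll C"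
    using clique by (auto simp: covering_clique_def)
  have "?G \<subseteq> UNIV \<times> (Cu \<union> Cv)" by (auto simp: gamma_verts_def)
  then have "finite ?G" by (rule finite_subset) (simp add: fin)
  then have finC: "finite C" using C finite_subset by blast
  have step: "I (cc_step Cu Cv st)" if st: "I st" for st
  proof -
    obtain K W where KW: "st = (K, W)" by fastforce
    define K' where "K' = K \<union> {(True, X) | X. (True, X) \<in> W \<and> (\<exists>Q\<in>sM X. Q \<notin> covU W)}"
    have "(True, X) \<in> C" if X: "(True, X) \<in> W" "Q \<in> sM X" "Q \<notin> covU W" for X Q
    proof -
      have "X \<in> Cv" using X st KW by (auto simp: I_def gamma_verts_iff)
      then have "Q \<in> Qs" using sub X by blast
      then obtain s Y where Y: "(s, Y) \<in> C" "Q \<in> sM Y" using C(3) by (auto simp: covAll_iff dest!: subsetD)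
      moreover have s
        using X Y st KW by (cases s) (auto simp: I_def covU_iff)
      moreover from this have "Y \<in> Cv" using Y C by (auto simp: gamma_verts_iff)
      ultimately show ?thesis using disj[of X Y Q] \<open>X \<in> Cv\<close> X by auto
    qed
    then have K': "K' \<subseteq> C" using st KW by (auto simp: K'_def I_def)
    then have "C \<subseteq> {p \<in> W. \<not> (\<exists>y\<in>K'. y \<noteq> p \<and> \<not> gamma_adj Cu Cv p y)}"
      using st KW C(2) unfolding I_def by blast
    with K' st show ?thesis
      unfolding KW cc_step_def Let_def prod.case K'_def[symmetric] by (auto simp: I_def)
  qed
  \<comment> \<open>\<open>K\<close> grows strictly inside the finite \<open>C\<close>. The measure
    gives termination, without which \<open>while_option\<close> would return
    \<open>None\<close>.\<close>
  define f where "f = (\<lambda>(K :: (bool \<times> 'a struc) set, W :: (bool \<times> 'a struc) set). card C - card K)"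
  have decr: "f (cc_step Cu Cv st) < f st" if st: "I st" and cond: "cc_cond Qs st" for st
  proof -
    obtain K W K' W' where KW: "st = (K, W)" "cc_step Cu Cv st = (K', W')" by fastforce
    have "sM X \<subseteq> Qs" if "(s, X) \<in> ?G" for s X
      using sub that by (auto simp: gamma_verts_iff split: if_splits)
    moreover have "W \<subseteq> ?G" "K \<subseteq> ?G" using st C(1) by (auto simp: KW I_def)
    \<comment> \<open>Coverage never exceeds \<open>Qs\<close>, so the loop condition can hold only
      because some component \<open>Q\<close> is uncovered.\<close>
    ultimately have sub': "covU W \<union> covAll K \<subseteq> Qs"
      unfolding covU_def covAll_def by blast
    then obtain Q where Q: "Q \<in> Qs" "Q \<notin> covU W" "Q \<notin> covAll K"
      using cond KW by (auto simp: cc_cond_def)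
    have "Qs \<subseteq> covAll W" using cond KW by (simp add: cc_cond_def cc_flag_def)
    with Q obtain s X where X: "(s, X) \<in> W" "Q \<in> sM X"
      by (meson covAll_iff subsetD)
    with Q have "s" by (cases s) (auto simp: covU_iff)
    with X Q KW have "(True, X) \<in> K'" "(True, X) \<notin> K" "K \<subseteq> K'"
      by (auto simp: cc_step_def Let_def covAll_iff)
    then have "K \<subset> K'" by blast
    moreover have "K' \<subseteq> C" using step[OF st] KW by (auto simp: I_def)
    ultimately have "card K < card K'" "card K' \<le> card C"
      using finC by (auto intro: psubset_card_mono card_mono finite_subset)
    then show ?thesis unfolding KW(2) f_def using KW(1) by simp
  qed
  have init: "I ({}, ?G)" using C by (auto simp: I_def)
  obtain t where t: "while_option (cc_cond Qs) (cc_step Cu Cv) ({}, ?G) = Some t"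
    using measure_while_option_Some[of I "cc_cond Qs" "cc_step Cu Cv" f, OF _ init] step decr by blast
  obtain K W where KW: "t = (K, W)" by fastforce
  have "I t" using while_option_rule[OF _ t, of I] step init by blast
  then have "covAll C \<subseteq> covAll W" unfolding KW I_def covAll_def by blast
  then show ?thesis
    using C(3) by (auto simp: check_clique_def t KW cc_flag_def)
qed

section \<open>From a spanner to a clique\<close>

text \<open>A spanner with a central edge, its stretch stated on edges of \<open>E\<close> only. The
  assumptions are symmetric in \<open>u\<close> and \<open>v\<close>, so \<open>swap\<close>
  transfers every result to the other side.\<close>

locale central = tree V F for V :: "'a set" and F +
  fixes E :: "'a set set" and u v :: 'a
  assumes sub: "F \<subseteq> E" and uv: "(u, v) \<in> adj F"
    and stretch: "\<And>a b. (a, b) \<in> adj E \<Longrightarrow> ndist F a b \<le> 3"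
    and graphE: "graph V E"
    and near: "\<And>t. t \<in> V \<Longrightarrow> ndist F t u \<le> 2 \<or> ndist F t v \<le> 2"
begin

lemma swap: "central V F E v u"
  using sub uv stretch graphE near adj_sym[of u v F] tree_axioms
  by (auto simp: central_def central_axioms_def)

lemma adj_sub: "(a, b) \<in> adj F \<Longrightarrow> (a, b) \<in> adj E"
  using sub by (auto simp: adj_iff)

lemma uV: "u \<in> V" "v \<in> V"
  using uv adj_V by auto

lemma ndist_far_ge:
  assumes "z \<in> V" "z \<noteq> u" "(u, z) \<notin> adj E"
  shows "2 \<le> ndist F z u"
proof (rule ccontr)
  assume "\<not> ?thesis"
  then consider "ndist F z u = 0" | "ndist F z u = 1" by linarith
  then show False
  proof cases
    case 1
    then show False using ndist_0 assms uV by blast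
  next
    case 2
    then have "(z, u) \<in> adj F" using ndist_relpow[of z u] assms uV by simp
    then show False using assms adj_sub adj_sym by fast
  qed
qed

text \<open>\<open>z\<close> has depth at least 2, so an edge to the side of \<open>v\<close> spends
  the whole stretch of 3 on reaching \<open>v\<close> and must end there.\<close>

lemma neighbour_side:
  assumes "z \<in> V" "z \<in> side F u v" "z \<noteq> u" "(u, z) \<notin> adj E" "(z, y) \<in> adj E"
  shows "y \<in> side F u v \<or> y = v"
proof (rule ccontr)
  assume neg: "\<not> ?thesis"
  have y: "y \<in> V" using graph_adjD[OF graphE assms(5)] by simp
  then have "y \<in> side F v u" using side_cover[OF uv] neg by blast
  from ndist_cross[OF uv assms(1) y assms(2) this] ndist_far_ge[OF assms(1,3,4)] stretch[OF assms(5)]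
  have "ndist F v y = 0" by linarith
  then show False using ndist_0[of v y] neg uV y by blast
qed

text \<open>On the side of \<open>u\<close>, \<open>z\<close> is nearer to \<open>u\<close> than to
  \<open>v\<close>, so \<open>near\<close> puts it at distance exactly 2 from
  \<open>u\<close>.\<close>

lemma parent_ex:
  assumes "z \<in> V" "z \<in> side F u v" "z \<noteq> u" "(u, z) \<notin> adj E"
  shows "\<exists>w. (z, w) \<in> adj F \<and> (w, u) \<in> adj F"
proof -
  have "ndist F z u = 2"
    using ndist_far_ge[OF assms(1,3,4)] ndist_cross_end[OF uv assms(1,2)] near[OF assms(1)] by linarith
  then have "(z, u) \<in> adj F ^^ Suc (Suc 0)"
    using ndist_relpow[of z u] assms uV by (simp add: numeral_2_eq_2)
  then show ?thesis by auto
qed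

text \<open>With different parents, the tree path from \<open>z\<close> to \<open>y\<close> would
  pass through both parents and \<open>u\<close>, a length of at least 4.\<close>

lemma parent_same:
  assumes z: "z \<in> V" "z \<in> side F u v" "z \<noteq> u" "(z, w) \<in> adj F" "(w, u) \<in> adj F"
    and zE: "(u, z) \<notin> adj E" and zy: "(z, y) \<in> adj E" and y: "y \<noteq> u" "(u, y) \<notin> adj E"
  shows "(y, w) \<in> adj F \<and> y \<in> side F u v"
proof -
  have yV: "y \<in> V" using graph_adjD[OF graphE zy] by simp
  have "y \<noteq> v" using y adj_sub[OF uv] by auto
  then have ys: "y \<in> side F u v"
    using neighbour_side[OF z(1-3) zE zy] by blast
  then obtain w' where w': "(y, w') \<in> adj F" "(w', u) \<in> adj F"
    using parent_ex[OF yV _ y] by blast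
  have "w = w'"
  proof (rule ccontr)
    assume ne: "w \<noteq> w'"
    \<comment> \<open>The cut is now at the edge \<open>wu\<close>: \<open>z\<close> lies on the
      side of \<open>w\<close> and \<open>y\<close> on the side of \<open>u\<close>.\<close>
    have zw: "z \<in> side F w u"
      using side_step[OF side_self, of w z F u] z by (auto simp: adj_sym doubleton_eq_iff)
    have uw': "(u, w') \<in> adj F" "(w', y) \<in> adj F" "w' \<noteq> u"
      using w' adj_sym by (fast, fast, simp add: adj_iff)
    then have "w' \<in> side F u w"
      using side_step[OF side_self, of u w' F w] ne by (auto simp: doubleton_eq_iff)
    from side_step[OF this uw'(2)] uw' ne y have yu: "y \<in> side F u w"
      by (auto simp: doubleton_eq_iff)
    have "ndist F z w + 1 + ndist F u y \<le> ndist F z y"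
      by (rule ndist_cross[OF z(5) z(1) yV zw yu])
    moreover have "ndist F z w \<noteq> 0"
      using ndist_0[of z w] adj_V[OF z(4)] z(4) by (auto simp: adj_iff)
    moreover have "2 \<le> ndist F u y"
      using ndist_far_ge[OF yV y] ndist_sym uV yV by simp
    ultimately show False using stretch[OF zy] by linarith
  qed
  with w' ys show ?thesis by simp
qed

text \<open>The parent \<open>w\<close> of one vertex is inherited along edges by the entire outer
  component, which therefore stays on the side of \<open>u\<close> and has \<open>w\<close> in
  \<open>sR\<close>.\<close>

lemma structure_on_side:
  assumes Q: "Q \<in> Qset V E u v" and meet: "Q \<inter> side F u v \<noteq> {}"
  shows "outer_comp V E u Q \<subseteq> side F u v" "onbh_set E (outer_comp V E u Q) \<subseteq> side F u v \<union> {v} - {u}"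
    "sR (S V E u v u Q) \<noteq> {}"
proof -
  interpret edge_structures V E u v u using graphE by unfold_locales auto
  obtain z where z: "z \<in> Q" "z \<in> side F u v" using meet by blast
  have zb: "z \<in> outer_comp V E u Q" using outer_comp_comps(2)[OF Q] z by blast
  note zf = outer_comp_not_cnbh[OF Q zb]
  obtain w where w: "(z, w) \<in> adj F" "(w, u) \<in> adj F"
    using parent_ex[of z] z zf by blast
  have all: "\<forall>y\<in>outer_comp V E u Q. (y, w) \<in> adj F \<and> y \<in> side F u v"
    using outer_comp_comps(1)[OF Q] zb
  proof (rule comps_induct)
    show "(z, w) \<in> adj F \<and> z \<in> side F u v" using w z by blast
  next
    fix y t assume "y \<in> outer_comp V E u Q" "(y, w) \<in> adj F \<and> y \<in> side F u v"
      "(y, t) \<in> adj E" "t \<in> V - cnbh E u"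
    then show "(t, w) \<in> adj F \<and> t \<in> side F u v"
      using parent_same[of y w t] w(2) outer_comp_not_cnbh[OF Q] by (auto simp: cnbh_iff)
  qed
  then show "outer_comp V E u Q \<subseteq> side F u v" by blast
  show "onbh_set E (outer_comp V E u Q) \<subseteq> side F u v \<union> {v} - {u}"
  proof
    fix y assume y: "y \<in> onbh_set E (outer_comp V E u Q)"
    then obtain t where t: "t \<in> outer_comp V E u Q" "(t, y) \<in> adj E"
      by (auto simp: onbh_set_iff)
    have "y \<noteq> u" using onbh_outer_comp[OF Q y] by (auto simp: adj_iff)
    with neighbour_side[of t y] t all outer_comp_not_cnbh[OF Q t(1)]
    show "y \<in> side F u v \<union> {v} - {u}" by blast
  qed
  have "(u, w) \<in> adj E" using w(2) adj_sub adj_sym by fast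
  then have "w \<notin> outer_comp V E u Q" using outer_comp_not_cnbh[OF Q] by blast
  moreover have "outer_comp V E u Q \<subseteq> nbh E w"
    using all adj_sub adj_sym by (fastforce simp: nbh_iff)
  ultimately have "w \<in> sR (S V E u v u Q)"
    using zb w adj_sub by (auto simp: S_simps onbh_set_iff)
  then show "sR (S V E u v u Q) \<noteq> {}" by blast
qed

end

text \<open>Every component is covered in the end and determines its structure, so all admissible
  sequences of picks yield the same set. This removes the choice of picks from the rest of the
  proof.\<close>

lemma constructed_structures:
  assumes "graph V E" "x = u \<or> x = v" "valid_constr V E u v x qs"
  shows "S V E u v x ` set qs = S V E u v x ` Qset V E u v"
proof -
  interpret edge_structures V E u v x using assms by unfold_locales
  have qs: "set qs \<subseteq> \<Q>"
    using assms(3) by (auto simp: valid_constr_def in_set_conv_nth)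
  have "S V E u v x Q \<in> S V E u v x ` set qs" if "Q \<in> \<Q>" for Q
  proof -
    have "Q \<in> \<Union> (sM ` S V E u v x ` set qs)"
      using assms(3) that unfolding valid_constr_def by blast
    then obtain q where "q \<in> set qs" "Q \<in> sM (S V E u v x q)" by blast
    then show ?thesis using S_eq_if_sM[of q Q] qs by auto
  qed
  with qs show ?thesis by blast
qed

text \<open>Each component meets a side of the central edge and contributes its structure
  there.\<close>

lemma (in central) clique_exists:
  "\<exists>C. covering_clique (Qset V E u v) (S V E u v u ` Qset V E u v) (S V E u v v ` Qset V E u v) C"
proof -
  interpret vu: central V F E v u by (rule swap)
  interpret eu: edge_structures V E u v u using graphE by unfold_locales auto
  interpret ev: edge_structures V E u v v using graphE by unfold_locales auto
  let ?Q = "Qset V E u v"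
  \<comment> \<open>\<open>S\<close> uses the pair \<open>u\<close>, \<open>v\<close> only through
    the symmetric \<open>Qset\<close>, so the swapped locale speaks of the same structures.\<close>
  have S_swap: "S V E v u = S V E u v"
    unfolding S_def Qset_commute[of V E v u] ..
  note on_u = structure_on_side
  note on_v = vu.structure_on_side[unfolded S_swap Qset_commute[of V E v u]]
  define Cu where "Cu = S V E u v u ` {Q \<in> ?Q. Q \<inter> side F u v \<noteq> {}}"
  define Cv where "Cv = S V E u v v ` {Q \<in> ?Q. Q \<inter> side F v u \<noteq> {}}"
  define C where "C = Pair False ` Cu \<union> Pair True ` Cv"
  have "sR X \<noteq> {} \<and> X \<in> S V E u v u ` ?Q" if "X \<in> Cu" for X
    using that on_u(3) unfolding Cu_def by blast
  moreover have "sR X \<noteq> {} \<and> X \<in> S V E u v v ` ?Q" if "X \<in> Cv" for X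
    using that on_v(3) unfolding Cv_def by blast
  ultimately have "C \<subseteq> gamma_verts (S V E u v u ` ?Q) (S V E u v v ` ?Q)" (is "_ \<subseteq> ?G")
    by (auto simp: C_def gamma_verts_iff)
  moreover have cross: "cross_ok X Y" if XY: "X \<in> Cu" "Y \<in> Cv" for X Y
  proof -
    obtain P where P: "X = S V E u v u P" "P \<in> ?Q" "P \<inter> side F u v \<noteq> {}"
      using XY unfolding Cu_def by blast
    obtain Q where Q: "Y = S V E u v v Q" "Q \<in> ?Q" "Q \<inter> side F v u \<noteq> {}"
      using XY unfolding Cv_def by blast
    note u = on_u(1,2)[OF P(2,3)] and v = on_v(1,2)[OF Q(2,3)]
    have disj: "side F u v \<inter> side F v u = {}"
      using side_disjoint[OF uv] by blast
    have "A \<notin> sM Y" if A: "A \<in> sM X" for A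
    proof -
      have "A \<noteq> {}" using A comps_nonempty by (auto simp: P S_simps Qset_def)
      moreover have "A \<subseteq> side F u v" using A u by (auto simp: P S_simps)
      ultimately show ?thesis using v(1) disj by (auto simp: Q S_simps)
    qed
    moreover have "u \<notin> outer_comp V E u P" "v \<notin> outer_comp V E v Q"
      using eu.outer_comp_not_cnbh[OF P(2)] ev.outer_comp_not_cnbh[OF Q(2)] by blast+
    \<comment> \<open>Each set may contain the opposite end of the central edge but not its own,
      which keeps the two disjoint.\<close>
    then have "sU X \<union> sD X \<subseteq> side F u v \<union> {v} - {u}" "sU Y \<union> sD Y \<subseteq> side F v u \<union> {u} - {v}"
      using u v by (auto simp: P Q S_simps)
    then have "(sU X \<union> sD X) \<inter> (sU Y \<union> sD Y) = {}"
      using disj by blast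
    ultimately show ?thesis by (auto simp: cross_ok_def)
  qed
  moreover have "?Q \<subseteq> covAll C"
  proof
    fix Q assume Q: "Q \<in> ?Q"
    then obtain z where z: "z \<in> Q" "z \<in> V"
      using comps_nonempty[of Q E] Qset_far[OF Q] unfolding Qset_def by blast
    with side_cover[OF uv] consider "Q \<inter> side F u v \<noteq> {}" | "Q \<inter> side F v u \<noteq> {}" by blast
    then show "Q \<in> covAll C"
    proof cases
      case 1
      then have "(False, S V E u v u Q) \<in> C" using Q by (simp add: C_def Cu_def)
      then show ?thesis using eu.Q_in_sM[OF Q] unfolding covAll_iff by blast
    next
      case 2
      then have "(True, S V E u v v Q) \<in> C" using Q by (simp add: C_def Cv_def)
      then show ?thesis using ev.Q_in_sM[OF Q] unfolding covAll_iff by blast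
    qed
  qed
  moreover have "gamma_adj (S V E u v u ` ?Q) (S V E u v v ` ?Q) p q"
    if pq: "p \<in> C" "q \<in> C" "p \<noteq> q" for p q
  proof -
    have "p \<in> ?G" "q \<in> ?G" using pq \<open>C \<subseteq> ?G\<close> by auto
    moreover have "snd p \<in> Cv" if "fst p" "p \<in> C" for p using that by (auto simp: C_def)
    moreover have "snd p \<in> Cu" if "\<not> fst p" "p \<in> C" for p using that by (auto simp: C_def)
    ultimately show ?thesis using pq cross unfolding gamma_adj_def by blast
  qed
  ultimately have "covering_clique ?Q (S V E u v u ` ?Q) (S V E u v v ` ?Q) C"
    unfolding covering_clique_def by blast
  then show ?thesis by blast
qed

lemma edge_yes_if_central:
  assumes "central V F E u v" "valid_constr V E u v u qsu" "valid_constr V E u v v qsv"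
  shows "edge_yes V E u v qsu qsv"
proof -
  interpret central V F E u v by fact
  interpret ev: edge_structures V E u v v using graphE by unfold_locales auto
  have Cu: "S V E u v u ` set qsu = S V E u v u ` Qset V E u v"
    and Cv: "S V E u v v ` set qsv = S V E u v v ` Qset V E u v"
    using constructed_structures[OF graphE _ assms(2)] constructed_structures[OF graphE _ assms(3)]
    by simp_all
  obtain C where C: "covering_clique (Qset V E u v) (S V E u v u ` set qsu) (S V E u v v ` set qsv) C"
    using clique_exists Cu Cv by auto
  have "check_clique (Qset V E u v) (S V E u v u ` set qsu) (S V E u v v ` set qsv)"
  proof (rule check_clique_complete[OF _ _ _ _ C])
    fix X Y Q
    assume "X \<in> S V E u v v ` set qsv" "Y \<in> S V E u v v ` set qsv" "Q \<in> sM X" "Q \<in> sM Y"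
    moreover from this obtain P P' where "X = S V E u v v P" "P \<in> Qset V E u v"
      "Y = S V E u v v P'" "P' \<in> Qset V E u v"
      unfolding Cv by blast
    ultimately show "X = Y" using ev.S_eq_if_sM[of P Q] ev.S_eq_if_sM[of P' Q] by simp
  qed (auto simp: S_simps)
  then show ?thesis by (simp add: edge_yes_def)
qed

lemma spanner_central_edge:
  assumes "graph V E" "has_T3SD5 V E" "E \<noteq> {}"
  shows "\<exists>F u v. central V F E u v"
proof -
  obtain F where F: "F \<subseteq> E" "is_tree V F" "\<And>a b. a \<in> V \<Longrightarrow> b \<in> V \<Longrightarrow> dist F a b \<le> enat 3 * dist E a b"
    "\<And>a b. a \<in> V \<Longrightarrow> b \<in> V \<Longrightarrow> dist F a b \<le> enat 5"
    using assms(2) by (auto simp: has_T3SD5_def tree_spanner_def diam_le_def)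
  interpret tree V F using F by unfold_locales
  \<comment> \<open>An edge of \<open>E\<close> gives two distinct vertices; since \<open>F\<close>
    connects them, \<open>F\<close> has an edge from which to start the search for a central
    one.\<close>
  obtain a b where ab: "a \<in> V" "b \<in> V" "a \<noteq> b"
    using assms(1,3) unfolding graph_def by blast
  have "(a, b) \<in> (adj F)\<^sup>*" using connected ab by blast
  then obtain c where "(a, c) \<in> adj F" using ab by (auto elim: converse_rtranclE)
  moreover have "ndist F a b \<le> 5" if "a \<in> V" "b \<in> V" for a b
    using F(4) ndist_le_iff that by blast
  ultimately obtain u v where uv: "(u, v) \<in> adj F" "\<forall>t\<in>V. ndist F t u \<le> 2 \<or> ndist F t v \<le> 2"
    using central_edge by blast
  have "ndist F a b \<le> 3" if "(a, b) \<in> adj E" for a b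
  proof -
    have V: "a \<in> V" "b \<in> V" using graph_adjD[OF assms(1) that] by auto
    have "dist E a b \<le> enat 1" using that unfolding dist_le_iff by (intro exI[of _ 1]) simp
    then have "enat 3 * dist E a b \<le> enat 3 * enat 1" by (rule mult_left_mono) simp
    with F(3)[OF V] have "dist F a b \<le> enat 3" by (auto intro: order_trans)
    then show ?thesis using ndist_le_iff V by blast
  qed
  then have "central V F E u v"
    using F uv assms(1) by unfold_locales auto
  then show ?thesis by blast
qed

section \<open>From a clique to a spanner\<close>

lemma dist_le_refl: "dist F a a \<le> enat n"
  unfolding dist_le_iff by (intro exI[of _ 0]) simp

lemma dist_le_adj: "(a, b) \<in> adj F \<Longrightarrow> dist F a b \<le> enat 1"
  unfolding dist_le_iff by (intro exI[of _ 1]) simp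

lemma dist_le_sym: "dist F a b \<le> enat n \<Longrightarrow> dist F b a \<le> enat n"
  unfolding dist_le_iff by (meson relpow_adj_sym)

lemma dist_le_trans:
  "dist F a b \<le> enat m \<Longrightarrow> dist F b c \<le> enat n \<Longrightarrow> m + n \<le> k \<Longrightarrow> dist F a c \<le> enat k"
  unfolding dist_le_iff by (meson relpow_trans add_mono le_trans)

lemma stretch_if_edges:
  assumes "0 < t" and edge: "\<And>a b. (a, b) \<in> adj E \<Longrightarrow> dist F a b \<le> enat t"
  shows "dist F a b \<le> enat t * dist E a b"
proof (cases "dist E a b")
  case (enat n)
  have "dist F a b \<le> enat (t * m)" if "(a, b) \<in> adj E ^^ m" for m b
    using that
  proof (induction m arbitrary: b)
    case 0
    then show ?case using dist_le_refl[of F a 0] by (simp add: zero_enat_def)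
  next
    case (Suc m)
    then obtain c where c: "(a, c) \<in> adj E ^^ m" "(c, b) \<in> adj E" by auto
    from dist_le_trans[OF Suc.IH[OF c(1)] edge[OF c(2)]] show ?case by simp
  qed
  moreover obtain m where "m \<le> n" "(a, b) \<in> adj E ^^ m"
    using enat dist_le_iff[of E a b n] by auto
  ultimately have "dist F a b \<le> enat (t * m)" by blast
  also have "\<dots> \<le> enat (t * n)" using \<open>m \<le> n\<close> by simp
  finally show ?thesis by (simp add: enat)
next
  case infinity
  \<comment> \<open>Positivity of \<open>t\<close> matters here, as 0 times infinity is 0.\<close>
  with \<open>0 < t\<close> show ?thesis by (simp add: zero_enat_def imult_is_infinity)
qed

text \<open>\<open>p\<close> is a parent map and \<open>l\<close> a level function. Following
  parents lowers the level until the root \<open>u\<close> is reached, which gives connectedness; a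
  vertex of maximal level rules out cycles.\<close>

lemma parent_tree:
  assumes "finite V" "u \<in> V"
    and p: "\<And>z. z \<in> V \<Longrightarrow> z \<noteq> u \<Longrightarrow> p z \<in> V \<and> l z = Suc (l (p z))"
    and F: "F = {{z, p z} | z. z \<in> V \<and> z \<noteq> u}"
  shows "is_tree V F"
proof -
  have pne: "p z \<noteq> z" if "z \<in> V" "z \<noteq> u" for z
    using p[OF that] by (metis n_not_Suc_n)
  have adjI: "(z, p z) \<in> adj F" if "z \<in> V" "z \<noteq> u" for z
    using that pne by (fastforce simp: adj_iff F)
  have adjD: "z \<in> V \<and> y \<in> V \<and> (z \<noteq> u \<and> y = p z \<or> l y = Suc (l z))" if zy: "(z, y) \<in> adj F" for z y
  proof -
    obtain x where "x \<in> V" "x \<noteq> u" "{z, y} = {x, p x}" using zy by (auto simp: adj_iff F)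
    then show ?thesis using p[of x] by (auto simp: doubleton_eq_iff)
  qed
  have "graph V F"
    unfolding graph_def
  proof (intro conjI ballI)
    fix e assume "e \<in> F"
    then obtain z where "z \<in> V" "z \<noteq> u" "e = {z, p z}" by (auto simp: F)
    then show "\<exists>a b. e = {a, b} \<and> a \<noteq> b \<and> a \<in> V \<and> b \<in> V"
      using p pne by metis
  qed (rule assms)
  moreover have "reach_in F V a b" if ab: "a \<in> V" "b \<in> V" for a b
  proof -
    have root: "(z, u) \<in> (adj F \<inter> V \<times> V)\<^sup>*" if "z \<in> V" for z
      using that
    proof (induction "l z" arbitrary: z rule: less_induct)
      case less
      show ?case
      proof (cases "z = u")
        case False
        then have "(p z, u) \<in> (adj F \<inter> V \<times> V)\<^sup>*" using less p[of z] by simp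
        moreover have "(z, p z) \<in> adj F \<inter> V \<times> V" using adjI[of z] p[of z] less False by blast
        ultimately show ?thesis by (rule converse_rtrancl_into_rtrancl[rotated])
      qed simp
    qed
    have "sym (adj F \<inter> V \<times> V)" by (auto intro!: symI simp: adj_sym)
    then have "(u, b) \<in> (adj F \<inter> V \<times> V)\<^sup>*"
      using root[OF ab(2)] by (auto intro: symD[OF sym_rtrancl])
    then show ?thesis
      using root[OF ab(1)] ab by (auto simp: reach_in_iff)
  qed
  moreover have False if cycle: "is_cycle F xs" for xs
  proof -
    obtain x ys where xs: "xs = x # ys" using cycle by (cases xs) (auto simp: is_cycle_def)
    \<comment> \<open>The closed list names its endpoint twice, while its tail \<open>ys\<close>
      lists each cycle vertex once, to be indexed cyclically.\<close>
    define m where "m = length ys"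
    have m: "3 \<le> m" and dist: "distinct ys" and lst: "ys ! (m - 1) = x"
      using cycle by (auto simp: is_cycle_def xs m_def last_conv_nth split: if_splits)
    have walk: "(xs ! i, xs ! Suc i) \<in> adj F" if "Suc i < length xs" for i
      using cycle that by (auto simp: is_cycle_def is_walk_def adj_iff)
    have first: "(ys ! (m - 1), ys ! 0) \<in> adj F"
      using walk[of 0] m lst by (cases ys) (auto simp: xs m_def)
    have step: "(ys ! i, ys ! Suc i) \<in> adj F" if "Suc i < m" for i
      using walk[of "Suc i"] that by (simp add: xs m_def)
    \<comment> \<open>Both cyclic neighbours of a vertex of maximal level are its parent.\<close>
    obtain i where i: "i < m" "\<And>j. j < m \<Longrightarrow> l (ys ! j) \<le> l (ys ! i)"
    proof -
      define M where "M = Max ((\<lambda>j. l (ys ! j)) ` {..<m})"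
      have "M \<in> (\<lambda>j. l (ys ! j)) ` {..<m}"
        unfolding M_def using m by (intro Max_in) (auto simp: lessThan_empty_iff)
      then obtain i where i: "i < m" "l (ys ! i) = M" by auto
      moreover have "l (ys ! j) \<le> M" if "j < m" for j
        unfolding M_def using that by (intro Max_ge) auto
      ultimately show ?thesis using that by simp
    qed
    define nxt where "nxt = (if Suc i = m then 0 else Suc i)"
    define prv where "prv = (if i = 0 then m - 1 else i - 1)"
    \<comment> \<open>The cyclic neighbours have different indices because \<open>m\<close> is at
      least 3.\<close>
    have bounds: "nxt < m" "prv < m" "nxt \<noteq> prv"
      using m i by (auto simp: nxt_def prv_def)
    have par: "ys ! j = p (ys ! i)" if "j < m" "(ys ! i, ys ! j) \<in> adj F" for j
      using adjD[OF that(2)] i(2)[OF that(1)] by auto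
    have "(ys ! i, ys ! nxt) \<in> adj F"
      using first step[of i] m i by (auto simp: nxt_def)
    moreover have "(ys ! i, ys ! prv) \<in> adj F"
      using first step[of "i - 1"] m i by (auto simp: prv_def adj_sym)
    ultimately have "ys ! nxt = ys ! prv" using par bounds by metis
    then show False using dist bounds by (simp add: nth_eq_iff_index_eq m_def)
  qed
  ultimately show ?thesis by (auto simp: is_tree_def)
qed

text \<open>\<open>Pu\<close>, \<open>Pv\<close> stand for the unions of the outer components chosen
  on each side, \<open>Du\<close>, \<open>Dv\<close> for their neighbourhoods, and
  \<open>wu\<close>, \<open>wv\<close> for the attachment vertices. An edge at \<open>Pu\<close>
  leads to \<open>Du\<close> at cost 2+1 or to a vertex with the same attachment at cost 1+1, and
  likewise at \<open>Pv\<close>; all other vertices are within 1 of \<open>u\<close> or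
  \<open>v\<close>, so edges among them cost at most 1+1+1.\<close>

lemma spanner_of_sides:
  assumes g: "graph V E" and uv: "(u, v) \<in> adj E"
    and cover: "\<And>z. z \<in> V \<Longrightarrow> z \<in> Pu \<union> Pv \<union> cnbh E u \<union> cnbh E v"
    and Pu: "\<And>z. z \<in> Pu \<Longrightarrow> z \<in> V \<and> z \<noteq> u \<and> (u, z) \<notin> adj E"
    and Du: "\<And>z. z \<in> Du \<Longrightarrow> (u, z) \<in> adj E"
    and wu: "\<And>z. z \<in> Pu \<Longrightarrow> wu z \<in> Du \<and> wu z \<noteq> v \<and> (z, wu z) \<in> adj E"
    and nu: "\<And>z y. z \<in> Pu \<Longrightarrow> (z, y) \<in> adj E \<Longrightarrow> y \<in> Du \<or> y \<in> Pu \<and> wu y = wu z"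
    and Pv: "\<And>z. z \<in> Pv \<Longrightarrow> z \<in> V \<and> z \<noteq> v \<and> (v, z) \<notin> adj E"
    and Dv: "\<And>z. z \<in> Dv \<Longrightarrow> (v, z) \<in> adj E"
    and wv: "\<And>z. z \<in> Pv \<Longrightarrow> wv z \<in> Dv \<and> wv z \<noteq> u \<and> (z, wv z) \<in> adj E"
    and nv: "\<And>z y. z \<in> Pv \<Longrightarrow> (z, y) \<in> adj E \<Longrightarrow> y \<in> Dv \<or> y \<in> Pv \<and> wv y = wv z"
    and disj: "(Pu \<union> Du) \<inter> (Pv \<union> Dv) = {}"
  shows "has_T3SD5 V E"
proof -
  have V: "u \<in> V" "v \<in> V" using graph_adjD[OF g uv] by auto
  have vu: "(v, u) \<in> adj E" "u \<noteq> v" using uv by (auto simp: adj_sym adj_iff)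
  have roots: "u \<notin> Pu" "v \<notin> Pu" "u \<notin> Pv" "v \<notin> Pv" "u \<notin> Du" "v \<notin> Dv"
    using Pu[of u] Pu[of v] Pv[of u] Pv[of v] Du[of u] Dv[of v] uv vu by (auto simp: adj_iff)
  have dj: "Pu \<inter> Pv = {}" "Pu \<inter> Dv = {}" "Du \<inter> Pv = {}" "Du \<inter> Dv = {}" "Pu \<inter> Du = {}" "Pv \<inter> Dv = {}"
    using disj Pu Du Pv Dv by blast+
  \<comment> \<open>The tree is rooted at \<open>u\<close>. Vertices in none of the four sets prefer
    \<open>u\<close> as parent and fall back to \<open>v\<close>; \<open>v\<close> itself may lie in
    \<open>Du\<close> and gets parent \<open>u\<close> in any case.\<close>
  define p where "p z = (if z \<in> Pu then wu z else if z \<in> Pv then wv z else if z = v \<or> z \<in> Du then u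
    else if z \<in> Dv then v else if (u, z) \<in> adj E then u else v)" for z
  \<comment> \<open>The level is the depth below \<open>u\<close>; \<open>Pv\<close> is at 3 because
    \<open>wv z \<noteq> u\<close> keeps its attachment vertices at 2.\<close>
  define l :: "'a \<Rightarrow> nat" where "l z = (if z = u then 0 else if z = v then 1 else if z \<in> Pu then 2
    else if z \<in> Pv then 3 else if p z = u then 1 else 2)" for z
  define F where "F = {{z, p z} | z. z \<in> V \<and> z \<noteq> u}"
  have pPu: "p z = wu z" if "z \<in> Pu" for z using that by (simp add: p_def)
  have pPv: "p z = wv z" if "z \<in> Pv" for z using that dj by (auto simp: p_def)
  have pv: "p v = u" using roots by (simp add: p_def)
  have pDu: "p z = u" if "z \<in> Du" for z using that dj by (auto simp: p_def)
  have pDv: "p z = v" if "z \<in> Dv" for z using that dj roots by (auto simp: p_def)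
  have prest: "p z = u \<or> p z = v" if "z \<notin> Pu" "z \<notin> Pv" for z using that by (auto simp: p_def)
  have pE: "(z, p z) \<in> adj E" if z: "z \<in> V" "z \<noteq> u" for z
  proof -
    consider "z \<in> Pu" | "z \<in> Pv" | "z \<notin> Pu" "z \<notin> Pv" by blast
    then show ?thesis
    proof cases
      case 3
      then have "z = v \<or> (u, z) \<in> adj E \<or> (v, z) \<in> adj E"
        using cover[OF z(1)] z(2) by (auto simp: cnbh_iff)
      then have "(p z, z) \<in> adj E" using 3 Du[of z] Dv[of z] uv unfolding p_def by auto
      then show ?thesis by (simp add: adj_sym)
    qed (use wu wv pPu pPv in auto)
  qed
  have pl: "p z \<in> V \<and> l z = Suc (l (p z))" if z: "z \<in> V" "z \<noteq> u" for z
  proof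
    show "p z \<in> V" using graph_adjD[OF g pE[OF z]] by simp
    consider "z = v" | "z \<in> Pu" | "z \<in> Pv" | "z \<notin> Pu" "z \<notin> Pv" "z \<noteq> v" by blast
    then show "l z = Suc (l (p z))"
    proof cases
      case 1
      then show ?thesis using vu pv by (simp add: l_def)
    next
      case 2
      then have w: "wu z \<in> Du" "wu z \<noteq> v" using wu by auto
      then have "wu z \<noteq> u" "wu z \<notin> Pu" "wu z \<notin> Pv" using roots dj by auto
      then have "l (wu z) = 1" using w pDu by (simp add: l_def)
      moreover have "l z = 2" using 2 roots by (auto simp: l_def)
      ultimately show ?thesis using pPu 2 by simp
    next
      case 3
      then have w: "wv z \<in> Dv" "wv z \<noteq> u" using wv by auto
      then have "wv z \<noteq> v" "wv z \<notin> Pu" "wv z \<notin> Pv" using roots dj by auto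
      then have "l (wv z) = 2" using w pDv vu by (simp add: l_def)
      moreover have "l z = 3" using 3 roots dj by (auto simp: l_def)
      ultimately show ?thesis using pPv 3 by simp
    next
      case 4
      then show ?thesis using prest[OF 4(1,2)] z vu by (auto simp: l_def)
    qed
  qed
  have tree: "is_tree V F"
    by (rule parent_tree[OF _ V(1) pl F_def]) (use g in \<open>simp add: graph_def\<close>)
  have sub: "F \<subseteq> E" using pE by (auto simp: F_def adj_iff)
  have pF: "dist F z (p z) \<le> enat 1" if "z \<in> V" "z \<noteq> u" for z
    using dist_le_adj[of z "p z" F] pE[OF that] that by (auto simp: F_def adj_iff)
  have duv: "dist F u v \<le> enat 1" "dist F v u \<le> enat 1"
    using pF[OF V(2)] pv vu dist_le_sym by auto
  have DVu: "z \<in> V" if "z \<in> Du" for z using graph_adjD[OF g Du[OF that]] by simp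
  have DVv: "z \<in> V" if "z \<in> Dv" for z using graph_adjD[OF g Dv[OF that]] by simp
  have dDu: "dist F z u \<le> enat 1" if "z \<in> Du" for z
    using pF[OF DVu[OF that]] that pDu roots by auto
  \<comment> \<open>The root \<open>u\<close> may lie in \<open>Dv\<close> and has no parent edge;
    the edge \<open>uv\<close> covers that case.\<close>
  have dDv: "dist F z v \<le> enat 1" if "z \<in> Dv" for z
    using pF[OF DVv[OF that]] that pDv[OF that] duv by (cases "z = u") auto
  have dPu: "dist F z (wu z) \<le> enat 1" "dist F z u \<le> enat 2" if "z \<in> Pu" for z
  proof -
    show "dist F z (wu z) \<le> enat 1" using pF[of z] Pu that pPu by auto
    then show "dist F z u \<le> enat 2"
      by (rule dist_le_trans) (use wu[OF that] dDu in auto)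
  qed
  have dPv: "dist F z (wv z) \<le> enat 1" "dist F z v \<le> enat 2" if "z \<in> Pv" for z
  proof -
    have "z \<noteq> u" using roots that by auto
    then show "dist F z (wv z) \<le> enat 1" using pF[of z] Pv that pPv by auto
    then show "dist F z v \<le> enat 2"
      by (rule dist_le_trans) (use wv[OF that] dDv in auto)
  qed
  have drest: "dist F z u \<le> enat 1 \<or> dist F z v \<le> enat 1" if "z \<in> V" "z \<notin> Pu" "z \<notin> Pv" for z
    using prest[OF that(2,3)] pF[of z] duv that(1) by (cases "z = u") auto
  have depth: "dist F z u \<le> enat 2 \<or> dist F z v \<le> enat 2" if "z \<in> V" for z
  proof -
    have "dist F z x \<le> enat 2" if "dist F z x \<le> enat 1" for x
      using that by (rule dist_le_trans[OF _ dist_le_refl[of F x 0]]) simp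
    then show ?thesis using drest[OF that] dPu(2) dPv(2) by blast
  qed
  \<comment> \<open>The middle 1 pays for the edge \<open>uv\<close>: depths 2 and 2 give diameter
    5, depths 1 and 1 give stretch 3.\<close>
  have near_uv: "dist F a b \<le> enat (i + 1 + j)"
    if ab: "dist F a u \<le> enat i \<or> dist F a v \<le> enat i" "dist F b u \<le> enat j \<or> dist F b v \<le> enat j" for a b i j
  proof -
    have "dist F x y \<le> enat 1" if "x \<in> {u, v}" "y \<in> {u, v}" for x y
      using that duv dist_le_refl by auto
    moreover obtain x where x: "x \<in> {u, v}" "dist F a x \<le> enat i" using ab by auto
    moreover obtain y where y: "y \<in> {u, v}" "dist F b y \<le> enat j" using ab by auto
    ultimately have "dist F a y \<le> enat (i + 1)"
      using dist_le_trans[OF x(2)] by blast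
    from dist_le_trans[OF this dist_le_sym[OF y(2)]] show ?thesis by simp
  qed
  have diam: "diam_le V F 5"
    unfolding diam_le_def
  proof (intro ballI)
    fix a b assume "a \<in> V" "b \<in> V"
    from near_uv[OF depth[OF this(1)] depth[OF this(2)]] show "dist F a b \<le> enat 5" by simp
  qed
  have edge_u: "dist F a b \<le> enat 3" if a: "a \<in> Pu" and ab: "(a, b) \<in> adj E" for a b
    using nu[OF a ab]
  proof
    assume "b \<in> Du"
    then show ?thesis
      using dist_le_trans[OF dPu(2)[OF a] dist_le_sym[OF dDu]] by simp
  next
    assume b: "b \<in> Pu \<and> wu b = wu a"
    then have "dist F (wu a) b \<le> enat 1" using dPu(1)[of b] dist_le_sym by auto
    from dist_le_trans[OF dPu(1)[OF a] this] show ?thesis by simp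
  qed
  have edge_v: "dist F a b \<le> enat 3" if a: "a \<in> Pv" and ab: "(a, b) \<in> adj E" for a b
    using nv[OF a ab]
  proof
    assume "b \<in> Dv"
    then show ?thesis
      using dist_le_trans[OF dPv(2)[OF a] dist_le_sym[OF dDv]] by simp
  next
    assume b: "b \<in> Pv \<and> wv b = wv a"
    then have "dist F (wv a) b \<le> enat 1" using dPv(1)[of b] dist_le_sym by auto
    from dist_le_trans[OF dPv(1)[OF a] this] show ?thesis by simp
  qed
  have "dist F a b \<le> enat 3" if ab: "(a, b) \<in> adj E" for a b
  proof -
    have ba: "(b, a) \<in> adj E" using ab by (simp add: adj_sym)
    have abV: "a \<in> V" "b \<in> V" using graph_adjD[OF g ab] by auto
    consider "a \<in> Pu \<union> Pv" | "b \<in> Pu \<union> Pv" | "a \<notin> Pu \<union> Pv" "b \<notin> Pu \<union> Pv" by blast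
    then show ?thesis
    proof cases
      case 1
      then show ?thesis using edge_u edge_v ab by blast
    next
      case 2
      then have "dist F b a \<le> enat 3" using edge_u edge_v ba by blast
      then show ?thesis by (rule dist_le_sym)
    next
      case 3
      then have "dist F a b \<le> enat (1 + 1 + 1)" using near_uv drest abV by blast
      then show ?thesis by (simp add: eval_nat_numeral)
    qed
  qed
  then have "tree_spanner 3 V E F"
    using sub tree stretch_if_edges[of 3 E F] by (simp add: tree_spanner_def)
  with diam show ?thesis by (auto simp: has_T3SD5_def)
qed

context edge_structures begin

text \<open>Adjacent vertices of the chosen components of \<open>G - N[x]\<close> lie in the same component, so a
  common neighbour chosen per component is constant along edges.\<close>
lemma attachment_exists:
  assumes A: "\<A> \<subseteq> \<Q>" and R: "\<And>Q. Q \<in> \<A> \<Longrightarrow> sR (S V E u v x Q) \<noteq> {}"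
  defines "P \<equiv> \<Union>(outer_comp V E x ` \<A>)" and "D \<equiv> \<Union>(onbh_set E ` outer_comp V E x ` \<A>)"
  shows "\<exists>w. \<forall>z\<in>P. w z \<in> D \<and> w z \<noteq> u \<and> w z \<noteq> v \<and> (z, w z) \<in> adj E \<and>
    (\<forall>y. (z, y) \<in> adj E \<longrightarrow> y \<in> D \<or> y \<in> P \<and> w y = w z)"
proof -
  define g where "g B = (SOME w. w \<in> onbh_set E B \<and> B \<subseteq> nbh E w)" for B
  define r where "r = (adj E \<inter> (V - cnbh E x) \<times> (V - cnbh E x))\<^sup>*"
  \<comment> \<open>The class of \<open>z\<close> under \<open>r\<close> is its outer component, so
    one arbitrary choice in \<open>g\<close> serves the whole component.\<close>
  define w where "w z = g {y. (z, y) \<in> r}" for z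
  have w: "w z = g (outer_comp V E x Q)" if "Q \<in> \<A>" "z \<in> outer_comp V E x Q" for z Q
    using comps_reach[OF outer_comp_comps(1), of Q z] that A unfolding w_def r_def by auto
  have g: "g (outer_comp V E x Q) \<in> onbh_set E (outer_comp V E x Q) \<and> outer_comp V E x Q \<subseteq> nbh E (g (outer_comp V E x Q))"
    if "Q \<in> \<A>" for Q
    unfolding g_def by (rule someI_ex) (use R[OF that] in \<open>auto simp: S_simps\<close>)
  have "w z \<in> D \<and> w z \<noteq> u \<and> w z \<noteq> v \<and> (z, w z) \<in> adj E \<and>
    (\<forall>y. (z, y) \<in> adj E \<longrightarrow> y \<in> D \<or> y \<in> P \<and> w y = w z)" if z: "z \<in> P" for z
  proof -
    obtain Q where Q: "Q \<in> \<A>" "z \<in> outer_comp V E x Q" using z unfolding P_def by blast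
    then have QQ: "Q \<in> \<Q>" using A by blast
    obtain q where q: "q \<in> Q" using comps_nonempty QQ unfolding Qset_def by blast
    \<comment> \<open>The attachment vertex is adjacent to \<open>q\<close>, which lies outside
      \<open>N[u,v]\<close>; hence it is neither \<open>u\<close> nor \<open>v\<close>.\<close>
    then have "(w z, q) \<in> adj E"
      using g[OF Q(1)] w[OF Q] outer_comp_comps(2)[OF QQ] by (auto simp: nbh_iff)
    then have "w z \<noteq> u" "w z \<noteq> v"
      using Qset_far[OF QQ q] by (auto simp: cnbh_iff)
    moreover have "w z \<in> D" "(z, w z) \<in> adj E"
      using g[OF Q(1)] w[OF Q] Q by (auto simp: D_def nbh_iff adj_sym)
    moreover have "y \<in> D \<or> y \<in> P \<and> w y = w z" if "(z, y) \<in> adj E" for y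
      using outer_comp_step[OF QQ Q(2) that] w[OF Q] w[OF Q(1)] Q(1) by (auto simp: D_def P_def)
    ultimately show ?thesis by blast
  qed
  then show ?thesis by blast
qed

end

text \<open>The clique decides which outer components hang on which side. Coverage accounts for
  every vertex outside \<open>N[u,v]\<close>, and adjacency in \<Gamma> keeps the sides
  apart.\<close>

lemma spanner_if_clique:
  assumes g: "graph V E" and uv: "(u, v) \<in> adj E"
    and C: "covering_clique (Qset V E u v) (S V E u v u ` Qset V E u v) (S V E u v v ` Qset V E u v) C"
  shows "has_T3SD5 V E"
proof -
  interpret eu: edge_structures V E u v u using g by unfold_locales auto
  interpret ev: edge_structures V E u v v using g by unfold_locales auto
  let ?Q = "Qset V E u v"
  define Au where "Au = {Q \<in> ?Q. (False, S V E u v u Q) \<in> C}"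
  define Av where "Av = {Q \<in> ?Q. (True, S V E u v v Q) \<in> C}"
  define Pu where "Pu = \<Union>(outer_comp V E u ` Au)"
  define Pv where "Pv = \<Union>(outer_comp V E v ` Av)"
  define Du where "Du = \<Union>(onbh_set E ` outer_comp V E u ` Au)"
  define Dv where "Dv = \<Union>(onbh_set E ` outer_comp V E v ` Av)"
  have A: "Au \<subseteq> ?Q" "Av \<subseteq> ?Q" by (auto simp: Au_def Av_def)
  have CG: "C \<subseteq> gamma_verts (S V E u v u ` ?Q) (S V E u v v ` ?Q)"
    using C by (simp add: covering_clique_def)
  have Ru: "sR (S V E u v u Q) \<noteq> {}" if "Q \<in> Au" for Q
    using that CG by (auto simp: Au_def gamma_verts_iff dest!: subsetD)
  have Rv: "sR (S V E u v v Q) \<noteq> {}" if "Q \<in> Av" for Q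
    using that CG by (auto simp: Av_def gamma_verts_iff dest!: subsetD)
  obtain wu where wu: "\<And>z. z \<in> Pu \<Longrightarrow> wu z \<in> Du \<and> wu z \<noteq> u \<and> wu z \<noteq> v \<and> (z, wu z) \<in> adj E \<and>
    (\<forall>y. (z, y) \<in> adj E \<longrightarrow> y \<in> Du \<or> y \<in> Pu \<and> wu y = wu z)"
    using eu.attachment_exists[OF A(1) Ru, folded Pu_def Du_def] by metis
  obtain wv where wv: "\<And>z. z \<in> Pv \<Longrightarrow> wv z \<in> Dv \<and> wv z \<noteq> u \<and> wv z \<noteq> v \<and> (z, wv z) \<in> adj E \<and>
    (\<forall>y. (z, y) \<in> adj E \<longrightarrow> y \<in> Dv \<or> y \<in> Pv \<and> wv y = wv z)"
    using ev.attachment_exists[OF A(2) Rv, folded Pv_def Dv_def] by metis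
  have Pu: "z \<in> V \<and> z \<noteq> u \<and> (u, z) \<notin> adj E" if "z \<in> Pu" for z
    using that eu.outer_comp_not_cnbh A unfolding Pu_def by blast
  have Pv: "z \<in> V \<and> z \<noteq> v \<and> (v, z) \<notin> adj E" if "z \<in> Pv" for z
    using that ev.outer_comp_not_cnbh A unfolding Pv_def by blast
  have Du: "(u, z) \<in> adj E" if "z \<in> Du" for z
    using that eu.onbh_outer_comp A unfolding Du_def by blast
  have Dv: "(v, z) \<in> adj E" if "z \<in> Dv" for z
    using that ev.onbh_outer_comp A unfolding Dv_def by blast
  have cover: "z \<in> Pu \<union> Pv \<union> cnbh E u \<union> cnbh E v" if z: "z \<in> V" for z
  proof (rule ccontr)
    assume neg: "\<not> ?thesis"
    then have "z \<in> V - (cnbh E u \<union> cnbh E v)" using z by blast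
    from comps_cover[OF this, of E] obtain Q where Q: "Q \<in> ?Q" "z \<in> Q"
      unfolding Qset_def by blast
    moreover have "?Q \<subseteq> covAll C" using C by (simp add: covering_clique_def)
    ultimately obtain s X where X: "(s, X) \<in> C" "Q \<in> sM X" by (meson covAll_iff subsetD)
    then have "X \<in> (if s then S V E u v v ` ?Q else S V E u v u ` ?Q)"
      using CG gamma_verts_iff by (metis subsetD)
    then obtain B where B: "B \<in> ?Q" "X = (if s then S V E u v v B else S V E u v u B)"
      by (auto split: if_splits)
    have "z \<in> Pu \<union> Pv"
    proof (cases s)
      case True
      then have "B \<in> Av" "z \<in> outer_comp V E v B" using B X Q by (auto simp: Av_def S_simps)
      then show ?thesis by (auto simp: Pv_def)
    next
      case False
      then have "B \<in> Au" "z \<in> outer_comp V E u B" using B X Q by (auto simp: Au_def S_simps)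
      then show ?thesis by (auto simp: Pu_def)
    qed
    with neg show False by blast
  qed
  have disj: "(Pu \<union> Du) \<inter> (Pv \<union> Dv) = {}"
  proof (rule ccontr)
    assume "\<not> ?thesis"
    then obtain z where z: "z \<in> Pu \<union> Du" "z \<in> Pv \<union> Dv" by blast
    obtain P where P: "P \<in> Au" and zP: "z \<in> outer_comp V E u P \<union> onbh_set E (outer_comp V E u P)"
      using z(1) unfolding Pu_def Du_def by blast
    obtain Q where Q: "Q \<in> Av" and zQ: "z \<in> outer_comp V E v Q \<union> onbh_set E (outer_comp V E v Q)"
      using z(2) unfolding Pv_def Dv_def by blast
    let ?X = "S V E u v u P" and ?Y = "S V E u v v Q"
    have PQ: "P \<in> ?Q" "Q \<in> ?Q" using P Q A by auto
    have "gamma_adj (S V E u v u ` ?Q) (S V E u v v ` ?Q) (False, ?X) (True, ?Y)"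
      using C P Q unfolding covering_clique_def Au_def Av_def by blast
    then have cross: "sM ?X \<inter> sM ?Y = {}" "(sU ?X \<union> sD ?X) \<inter> (sU ?Y \<union> sD ?Y) = {}"
      by (auto simp: gamma_adj_def cross_ok_def)
    have X: "z \<in> \<Union>(sM ?X) \<or> z \<in> sU ?X \<union> sD ?X"
      using zP eu.outer_comp_conv[OF PQ(1)] by (auto simp: S_simps(3))
    have Y: "z \<in> \<Union>(sM ?Y) \<or> z \<in> sU ?Y \<union> sD ?Y"
      using zQ ev.outer_comp_conv[OF PQ(2)] by (auto simp: S_simps(3))
    have far: "z \<notin> cnbh E u \<union> cnbh E v" if "z \<in> \<Union>(sM (S V E u v x B))" for x B
      using that Qset_far[of _ V E u v z] unfolding S_simps by blast
    have near_X: "z \<in> cnbh E u \<union> cnbh E v" if "z \<in> sU ?X \<union> sD ?X"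
      using that eu.sU_near[OF PQ(1)] eu.onbh_outer_comp[OF PQ(1)] by (auto simp: S_simps(3) cnbh_iff)
    have near_Y: "z \<in> cnbh E u \<union> cnbh E v" if "z \<in> sU ?Y \<union> sD ?Y"
      using that ev.sU_near[OF PQ(2)] ev.onbh_outer_comp[OF PQ(2)] by (auto simp: S_simps(3) cnbh_iff)
    show False
    \<comment> \<open>A common vertex inside \<open>N[u,v]\<close> would lie in both sets
      \<open>sU \<union> sD\<close>; outside, it would lie in a component covered by both
      structures.\<close>
    proof (cases "z \<in> cnbh E u \<union> cnbh E v")
      case True
      then show False using X Y far cross(2) by blast
    next
      case False
      then obtain B B' where B: "B \<in> sM ?X" "z \<in> B" "B' \<in> sM ?Y" "z \<in> B'"
        using X Y near_X near_Y by blast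
      then have "B = B'"
        using comps_eq[of B E _ B' z] by (auto simp: S_simps Qset_def)
      with B cross(1) show False by blast
    qed
  qed
  show ?thesis
    using cover Pu Du _ _ Pv Dv _ _ disj
  proof (rule spanner_of_sides[OF g uv])
    show "wu z \<in> Du \<and> wu z \<noteq> v \<and> (z, wu z) \<in> adj E" if "z \<in> Pu" for z
      using wu[OF that] by blast
    show "y \<in> Du \<or> y \<in> Pu \<and> wu y = wu z" if "z \<in> Pu" "(z, y) \<in> adj E" for z y
      using wu[OF that(1)] that(2) by blast
    show "wv z \<in> Dv \<and> wv z \<noteq> u \<and> (z, wv z) \<in> adj E" if "z \<in> Pv" for z
      using wv[OF that] by blast
    show "y \<in> Dv \<or> y \<in> Pv \<and> wv y = wv z" if "z \<in> Pv" "(z, y) \<in> adj E" for z y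
      using wv[OF that(1)] that(2) by blast
  qed
qed

lemma spanner_if_edge_yes:
  assumes g: "graph V E" and uv: "(u, v) \<in> adj E"
    and q: "valid_constr V E u v u qsu" "valid_constr V E u v v qsv"
    and yes: "edge_yes V E u v qsu qsv"
  shows "has_T3SD5 V E"
proof -
  have "\<exists>C. covering_clique (Qset V E u v) (S V E u v u ` set qsu) (S V E u v v ` set qsv) C"
  proof (cases "Qset V E u v = {}")
    \<comment> \<open>The immediate YES for empty \<Q> corresponds to the empty clique.\<close>
    case True
    then show ?thesis by (intro exI[of _ "{}"]) (simp add: covering_clique_def)
  next
    case False
    then show ?thesis using yes check_clique_sound unfolding edge_yes_def by blast
  qed
  then show ?thesis
    using spanner_if_clique[OF g uv] constructed_structures[OF g _ q(1)] constructed_structures[OF g _ q(2)]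
    by auto
qed

section \<open>Runs of the algorithm and the equivalence\<close>

lemma run_edges_iff:
  "run_edges V E r \<longleftrightarrow> (\<exists>(u, v, qsu, qsv)\<in>set r. edge_yes V E u v qsu qsv)"
  by (induction V E r rule: run_edges.induct) auto

lemma edgeless_spanner_iff:
  assumes "graph V {}"
  shows "has_T3SD5 V {} \<longleftrightarrow> card V \<le> 1"
proof
  have adj: "adj {} = {}" by (simp add: adj_def)
  assume "has_T3SD5 V {}"
  then have "reach_in {} V a b" if "a \<in> V" "b \<in> V" for a b
    using that by (auto simp: has_T3SD5_def tree_spanner_def is_tree_def)
  then have "a = b" if "a \<in> V" "b \<in> V" for a b
    using that by (auto simp: reach_in_iff adj)
  then show "card V \<le> 1"
    by (metis card_le_Suc0_iff_eq One_nat_def assms graph_def)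
next
  assume "card V \<le> 1"
  then have one: "a = b" if "a \<in> V" "b \<in> V" for a b
    using that assms by (auto simp: graph_def card_le_Suc0_iff_eq)
  have "\<not> is_cycle {} xs" for xs :: "'a list"
    by (cases xs rule: remdups_adj.cases) (auto simp: is_cycle_def is_walk_successively adj_iff)
  then have "is_tree V {}"
    using assms one by (auto simp: is_tree_def reach_in_iff)
  moreover have d0: "dist {} a b \<le> enat 0" if "a \<in> V" "b \<in> V" for a b
    using one[OF that] dist_le_refl by simp
  moreover have "dist {} a b \<le> x" if "a \<in> V" "b \<in> V" for a b x
    using d0[OF that] by (simp add: zero_enat_def[symmetric])
  ultimately show "has_T3SD5 V {}"
    unfolding has_T3SD5_def tree_spanner_def diam_le_def by (intro exI[of _ "{}"]) simp
qed

theorem theorem1: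
  fixes V :: "'a set" and E :: "'a set set" and r :: "'a run"
  assumes "graph V E"
    and "valid_run V E r"
  shows "has_T3SD5 V E \<longleftrightarrow> T3SD5 V E r"
proof (cases "E = {}")
  case True
  then show ?thesis using edgeless_spanner_iff assms by (simp add: T3SD5_def)
next
  case False
  have run: "{u, v} \<in> E \<and> u \<noteq> v \<and> valid_constr V E u v u qsu \<and> valid_constr V E u v v qsv"
    if "(u, v, qsu, qsv) \<in> set r" for u v qsu qsv
  proof -
    have "{u, v} \<in> (\<lambda>(u, v, _, _). {u, v}) ` set r"
      by (rule image_eqI[OF _ that]) simp
    then show ?thesis
      using bspec[OF assms(2)[unfolded valid_run_def, THEN conjunct2, THEN conjunct2] that]
        assms(2)[unfolded valid_run_def, THEN conjunct2, THEN conjunct1]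
      by simp
  qed
  show ?thesis
  proof
    assume "has_T3SD5 V E"
    then obtain F a b where c: "central V F E a b"
      using spanner_central_edge[OF assms(1)] False by blast
    then interpret central V F E a b .
    have "{a, b} \<in> E" using adj_sub[OF uv] by (simp add: adj_iff)
    then have "{a, b} \<in> set (map (\<lambda>(u, v, _, _). {u, v}) r)"
      using assms(2) by (simp add: valid_run_def)
    then obtain u v qsu qsv where e: "(u, v, qsu, qsv) \<in> set r" "{a, b} = {u, v}" by auto
    \<comment> \<open>The run may list the central edge in the opposite orientation.\<close>
    then have "central V F E u v"
      using c swap by (auto simp: doubleton_eq_iff)
    then have "edge_yes V E u v qsu qsv" using edge_yes_if_central[of V F E u v] run[OF e(1)] by simp
    with e False show "T3SD5 V E r" by (auto simp: T3SD5_def run_edges_iff)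
  next
    assume "T3SD5 V E r"
    then obtain u v qsu qsv where e: "(u, v, qsu, qsv) \<in> set r" "edge_yes V E u v qsu qsv"
      using False by (auto simp: T3SD5_def run_edges_iff)
    with run[OF e(1)] show "has_T3SD5 V E"
      using spanner_if_edge_yes[OF assms(1), of u v qsu qsv] by (simp add: adj_iff)
  qed
qed

end
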